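(* Let $d=3n$ with $n\ge 1$ an integer, and let $U_d\subset\mathbf{P}^3(\mathbb{C})$ be the surface of degree $d$ with affine equation $Q_d(x,y)+T_d(w)=0$, where $Q_d$ and $T_d$ are the polynomials defined in the context. Then the number of singular points of $U_d$ is $$\binom{d}{2}\left\lfloor\frac{d}{2}\right\rfloor+\left(\frac{d^2}{3}-d+1\right)\left\lfloor\frac{d-1}{2}\right\rfloor .$$ All the singular points are non-degenerate. The surface $U_d$ has no singular points at infinity.
   Context: The generalized cosine associated to the affine Weyl group of the root system $A_2$ is $h(u,v)=(h_1(u,v),h_2(u,v))$, where for real $u,v$ $$h_1(u,v)=e^{-2\pi i u}+e^{-2\pi i v}+e^{2\pi i(u+v)},\qquad h_2(u,v)=\overline{h_1(u,v)}.$$ For $d=3n$ define, for real $u,v$, $$g_{1,d}(u,v)=e^{-2\pi i(du+\frac23)}+e^{-2\pi i(dv-\frac13)}+e^{2\pi i(d(u+v)+\frac13)},\qquad g_{2,d}(u,v)=\overline{g_{1,d}(u,v)},$$ and $$H_d(u,v)=g_{1,d}(u,v)+g_{2,d}(u,v)=2\cos\left(2\pi du-\tfrac{2\pi}{3}\right)+2\cos\left(2\pi dv-\tfrac{2\pi}{3}\right)+2\cos\left(2\pi d(u+v)+\tfrac{2\pi}{3}\right).$$ The polynomial $Q_d\in\mathbb{C}[x,y]$ (written $Q_d=H_d\circ h^{-1}$) is the unique polynomial with complex coefficients such that $Q_d(h_1(u,v),h_2(u,v))=H_d(u,v)$ for all real $u,v$. The polynomial $T_d(w)$ is the Chebyshev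 polynomial of degree $d$ normalized to have the two critical values $2$ and $3$, with $\lfloor d/2\rfloor$ critical points of value $2$ and $\lfloor (d-1)/2\rfloor$ critical points of value $3$; explicitly, $T_d(w)=\frac{1}{2}(\tau_d(w)+5)$, where $\tau_d(\cos\theta)=\cos(d\theta)$. The surface $U_d$ in $\mathbf{P}^3(\mathbb{C})$ is the zero locus of the homogenization to degree $d$, with a fourth variable $z$, of $Q_d(x,y)+T_d(w)$; points at infinity are those with $z=0$. A singular point of $U_d$ is a point where all partial derivatives of the homogenized equation vanish. A singular point is non-degenerate (an ordinary double point) if, in an affine chart around it, the Hessian matrix of the local defining polynomial at that point is invertible. *)

theory Defs
  imports "HOL-Analysis.Analysis" "HOL-Computational_Algebra.Polynomial"
begin

definition h1 :: "real \<Rightarrow> real \<Rightarrow> complex" where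
  "h1 u v = cis (- 2 * pi * u) + cis (- 2 * pi * v) + cis (2 * pi * (u + v))"

definition h2 :: "real \<Rightarrow> real \<Rightarrow> complex" where
  "h2 u v = cnj (h1 u v)"

definition g1 :: "nat \<Rightarrow> real \<Rightarrow> real \<Rightarrow> complex" where
  "g1 d u v = cis (- 2 * pi * (real d * u + 2 / 3)) + cis (- 2 * pi * (real d * v - 1 / 3))
     + cis (2 * pi * (real d * (u + v) + 1 / 3))"

definition g2 :: "nat \<Rightarrow> real \<Rightarrow> real \<Rightarrow> complex" where
  "g2 d u v = cnj (g1 d u v)"

definition H :: "nat \<Rightarrow> real \<Rightarrow> real \<Rightarrow> complex" where
  "H d u v = g1 d u v + g2 d u v"

lemma H_eq_cos:
  "H d u v = of_real (2 * cos (2 * pi * d * u - 2 * pi / 3) + 2 * cos (2 * pi * d * v - 2 * pi / 3)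
     + 2 * cos (2 * pi * d * (u + v) + 2 * pi / 3))"
proof -
  have 1: "cos (- 2 * pi * (real d * u + 2 / 3)) = cos (2 * pi * d * u - 2 * pi / 3)"
  proof -
    have "cos (- 2 * pi * (real d * u + 2 / 3)) = cos (- (- 2 * pi * (real d * u + 2 / 3)))"
      by (simp only: cos_minus)
    also have "- (- 2 * pi * (real d * u + 2 / 3)) = (2 * pi * d * u - 2 * pi / 3) + 2 * pi"
      by (simp add: algebra_simps)
    finally show ?thesis by (simp only: cos_periodic)
  qed
  have 2: "cos (- 2 * pi * (real d * v - 1 / 3)) = cos (2 * pi * d * v - 2 * pi / 3)"
  proof -
    have "cos (- 2 * pi * (real d * v - 1 / 3)) = cos (- (- 2 * pi * (real d * v - 1 / 3)))"
      by (simp only: cos_minus)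
    also have "- (- 2 * pi * (real d * v - 1 / 3)) = 2 * pi * d * v - 2 * pi / 3"
      by (simp add: algebra_simps)
    finally show ?thesis .
  qed
  have 3: "cos (2 * pi * (real d * (u + v) + 1 / 3)) = cos (2 * pi * d * (u + v) + 2 * pi / 3)"
    by (rule arg_cong[where f = cos]) (simp add: algebra_simps)
  have "H d u v = of_real (2 * Re (g1 d u v))"
    by (simp add: H_def g2_def complex_add_cnj)
  also have "Re (g1 d u v) = cos (2 * pi * d * u - 2 * pi / 3) + cos (2 * pi * d * v - 2 * pi / 3)
     + cos (2 * pi * d * (u + v) + 2 * pi / 3)"
    by (simp only: g1_def plus_complex.sel cis.sel 1 2 3)
  finally show ?thesis by (simp add: algebra_simps)
qed

(* The type complex poly poly stands for C[x][y]: the coefficient of x^i y^j in Q is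
   coeff (coeff Q j) i. *)
definition poly2 :: "complex poly poly \<Rightarrow> complex \<Rightarrow> complex \<Rightarrow> complex" where
  "poly2 Q x y = poly (poly Q [:y:]) x"

definition Q_poly :: "nat \<Rightarrow> complex poly poly" where
  "Q_poly d = (THE Q. \<forall>u v. poly2 Q (h1 u v) (h2 u v) = H d u v)"

definition chebyshev :: "nat \<Rightarrow> complex poly" where
  "chebyshev d = (THE p. \<forall>\<theta>::real. poly p (of_real (cos \<theta>)) = of_real (cos (real d * \<theta>)))"

definition T_poly :: "nat \<Rightarrow> complex poly" where
  "T_poly d = smult (1 / 2) (chebyshev d + [:5:])"

(* Q_d(x,y) + T_d(w), as an element of C[x][y][w]. *)
definition affine_eq :: "nat \<Rightarrow> complex poly poly poly" where
  "affine_eq d = [:Q_poly d:] + map_poly (\<lambda>c. [:[:c:]:]) (T_poly d)"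

(* Homogeneous coordinates are (x, y, w, z) = (p $ 1, p $ 2, p $ 3, p $ 4).  The exponent of z is
   a truncated subtraction, so this is the homogenization to degree d only for f of total degree
   at most d. *)
definition homogenize :: "nat \<Rightarrow> complex poly poly poly \<Rightarrow> complex ^ 4 \<Rightarrow> complex" where
  "homogenize d f p =
     (\<Sum>k\<le>degree f. \<Sum>j\<le>degree (coeff f k). \<Sum>i\<le>degree (coeff (coeff f k) j).
        coeff (coeff (coeff f k) j) i * p $ 1 ^ i * p $ 2 ^ j * p $ 3 ^ k * p $ 4 ^ (d - (i + j + k)))"

definition U_eq :: "nat \<Rightarrow> complex ^ 4 \<Rightarrow> complex" where
  "U_eq d = homogenize d (affine_eq d)"

definition proj_rel :: "((complex ^ 4) \<times> (complex ^ 4)) set" where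
  "proj_rel = {(p, q). p \<noteq> 0 \<and> q \<noteq> 0 \<and> (\<exists>c. c \<noteq> 0 \<and> q = c *s p)}"

definition P3 :: "(complex ^ 4) set set" where
  "P3 = (UNIV - {0}) // proj_rel"

definition partial_deriv :: "'n \<Rightarrow> (complex ^ 'n \<Rightarrow> complex) \<Rightarrow> complex ^ 'n \<Rightarrow> complex" where
  "partial_deriv i f p = deriv (\<lambda>t. f (\<chi> j. if j = i then t else p $ j)) (p $ i)"

definition hessian :: "(complex ^ 'n \<Rightarrow> complex) \<Rightarrow> complex ^ 'n \<Rightarrow> complex ^ 'n ^ 'n" where
  "hessian f p = (\<chi> i j. partial_deriv i (partial_deriv j f) p)"

definition U :: "nat \<Rightarrow> (complex ^ 4) set set" where
  "U d = {L \<in> P3. \<forall>p\<in>L. U_eq d p = 0}"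

definition singular_points :: "nat \<Rightarrow> (complex ^ 4) set set" where
  "singular_points d = {L \<in> U d. \<forall>p\<in>L. \<forall>i. partial_deriv i (U_eq d) p = 0}"

(* The affine chart in which the coordinate with index a equals 1.  Indices are added modulo 4 in
   the type 4, so a + 1, a + 2, a + 3 are the other three; chart 4 maps (x, y, w) to (x, y, w, 1). *)
definition chart :: "4 \<Rightarrow> complex ^ 3 \<Rightarrow> complex ^ 4" where
  "chart a q = (\<chi> i. if i = a then 1 else if i = a + 1 then q $ 1
                     else if i = a + 2 then q $ 2 else q $ 3)"

definition nondegenerate :: "nat \<Rightarrow> (complex ^ 4) set \<Rightarrow> bool" where
  "nondegenerate d L \<longleftrightarrow>
     (\<exists>a q. chart a q \<in> L \<and> invertible (hessian (\<lambda>q. U_eq d (chart a q)) q))"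

definition at_infinity_pt :: "(complex ^ 4) set \<Rightarrow> bool" where
  "at_infinity_pt L \<longleftrightarrow> (\<forall>p\<in>L. p $ 4 = 0)"

end

theory Submission
  imports Defs "HOL-Complex_Analysis.Conformal_Mappings"
    "HOL-Computational_Algebra.Fundamental_Theorem_Algebra"
begin

text \<open>
  Why the theorem holds. Put \<open>x = r + s + t\<close> and \<open>y = 1/r + 1/s + 1/t\<close> with \<open>r * s * t = 1\<close>; every point of
  the complex plane has this form (\<open>exists_roots\<close>). With \<open>omega\<close> a primitive cube root of unity and
  \<open>R = omega * r ^ d\<close>, and likewise \<open>S\<close> and \<open>T\<close>, again \<open>R * S * T = 1\<close>, and \<open>Q_d(x, y)\<close> is the sum
  \<open>R + 1/R + S + 1/S + T + 1/T\<close> (\<open>poly2_folding_roots\<close>, \<open>Q_poly_eq_folding\<close>). In logarithmic coordinates on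
  the torus this is a sum of three values of \<open>2 cosh\<close>, whose critical points are visible: either
  \<open>R = S = T\<close> is a cube root of unity, with value 6 or \<open>-3\<close>, or \<open>{R, S, T}\<close> is \<open>{-1, -1, 1}\<close> with value \<open>-2\<close>
  (\<open>torus_critical_cases\<close>). At all of them the Hessian on the torus is invertible. At a critical point of
  \<open>Q_d\<close> the Hessian on the torus is the pullback of the Hessian of \<open>Q_d\<close> by the Jacobian matrix of
  \<open>(r, s, t) \<mapsto> (x, y)\<close>. Hence the Jacobian matrix is invertible too, so \<open>r\<close>, \<open>s\<close>, \<open>t\<close> are distinct, and
  the critical point of \<open>Q_d\<close> is non-degenerate (\<open>critical_point_imp\<close>); the discriminant curve, where the
  parametrization branches, needs no separate treatment.

  Critical points of \<open>Q_d\<close> therefore correspond to three-element sets with product 1 on which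
  \<open>R - 1/R\<close> is constant (\<open>bij_betw_crit_points\<close>), and those with value \<open>-2\<close> and \<open>-3\<close> can be counted
  (\<open>card_crit_triples_minus2\<close>, \<open>card_crit_triples_minus3\<close>). The same argument with \<open>w = cos \<theta>\<close> treats \<open>T_d\<close>.
  A finite singular point is a pair of critical points of \<open>Q_d\<close> and \<open>T_d\<close> with opposite values, and its
  Hessian is block diagonal. The plane at infinity cuts the surface in a Fermat curve, which is smooth
  (\<open>no_singularity_at_infinity\<close>).
\<close>

section \<open>Power sums of three numbers\<close>

text \<open>
  Newton's recursion for \<open>r ^ k + s ^ k + t ^ k\<close> in terms of the elementary symmetric functions
  \<open>a\<close>, \<open>b\<close>, \<open>c\<close> of \<open>r\<close>, \<open>s\<close>, \<open>t\<close>. It is polymorphic, so that one function serves both for polynomials and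
  for their values. The third argument stays a parameter, although it equals 1 at affine points,
  because homogenizing replaces it by \<open>z ^ 3\<close>.
\<close>
fun power_sum :: "'a::comm_ring_1 \<Rightarrow> 'a \<Rightarrow> 'a \<Rightarrow> nat \<Rightarrow> 'a" where
  "power_sum a b c 0 = 3"
| "power_sum a b c (Suc 0) = a"
| "power_sum a b c (Suc (Suc 0)) = a\<^sup>2 - 2 * b"
| "power_sum a b c (Suc (Suc (Suc k))) =
     a * power_sum a b c (Suc (Suc k)) - b * power_sum a b c (Suc k) + c * power_sum a b c k"

lemma power_sum_elementary_symmetric:
  "power_sum (r + s + t) (r * s + r * t + s * t) (r * s * t) k = r ^ k + s ^ k + t ^ k"
  by (induction "r + s + t" "r * s + r * t + s * t" "r * s * t" k rule: power_sum.induct)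
    (simp_all add: algebra_simps power2_eq_square)

text \<open>
  Multiplying \<open>r\<close>, \<open>s\<close>, \<open>t\<close> by \<open>z\<close> scales the elementary symmetric functions by \<open>z\<close>, \<open>z ^ 2\<close>, \<open>z ^ 3\<close>;
  this is what homogenization amounts to.
\<close>
lemma power_sum_scale:
  "power_sum (z * a) (z\<^sup>2 * b) (z ^ 3 * c) k = z ^ k * power_sum a b c k"
  by (induction a b c k rule: power_sum.induct)
    (simp_all add: algebra_simps power2_eq_square power3_eq_cube)

text \<open>
  At infinity only the leading form survives, and it is a pure power.
\<close>
lemma power_sum_leading: "power_sum a 0 0 (Suc k) = a ^ Suc k"
proof (induction k rule: less_induct)
  case (less k)
  consider "k = 0" | "k = 1" | l where "k = Suc (Suc l)"
    by (metis One_nat_def not0_implies_Suc)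
  then show ?case
    by cases (use less in \<open>auto simp: power2_eq_square\<close>)
qed

section \<open>Evaluation and differentiation in two variables\<close>

lemma poly2_simps [simp]:
  "poly2 (P + Q) x y = poly2 P x y + poly2 Q x y"
  "poly2 (P - Q) x y = poly2 P x y - poly2 Q x y"
  "poly2 (P * Q) x y = poly2 P x y * poly2 Q x y"
  "poly2 (P ^ k) x y = poly2 P x y ^ k"
  "poly2 (numeral m) x y = numeral m"
  "poly2 0 x y = 0"
  "poly2 1 x y = 1"
  "poly2 (smult c P) x y = poly c x * poly2 P x y"
  "poly2 (pCons c P) x y = poly c x + y * poly2 P x y"
  by (simp_all add: poly2_def)

definition pderiv_x :: "complex poly poly \<Rightarrow> complex poly poly" where
  "pderiv_x = map_poly pderiv"

lemma pderiv_x_pCons: "pderiv_x (pCons c Q) = pCons (pderiv c) (pderiv_x Q)"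
  by (simp add: pderiv_x_def map_poly_pCons)

lemma pderiv_x_pderiv: "pderiv_x (pderiv Q) = pderiv (pderiv_x Q)"
proof (rule poly_eqI)
  fix n
  show "coeff (pderiv_x (pderiv Q)) n = coeff (pderiv (pderiv_x Q)) n"
    by (rule poly_eqI) (simp add: pderiv_x_def coeff_map_poly coeff_pderiv of_nat_poly pderiv_smult
        flip: of_nat_Suc)
qed

text \<open>
  The chain rule along a curve. Every derivative of \<open>Q_d\<close> below is obtained from it by choosing a curve.
\<close>
lemma has_field_derivative_poly2:
  assumes "(X has_field_derivative X') (at s)" "(Y has_field_derivative Y') (at s)"
  shows "((\<lambda>s. poly2 Q (X s) (Y s)) has_field_derivative
           poly2 (pderiv_x Q) (X s) (Y s) * X' + poly2 (pderiv Q) (X s) (Y s) * Y') (at s)"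
proof (induction Q)
  case 0
  then show ?case by (simp add: pderiv_x_def)
next
  case (pCons c Q)
  have "((\<lambda>s. poly c (X s)) has_field_derivative poly (pderiv c) (X s) * X') (at s)"
    using DERIV_chain2[OF poly_DERIV assms(1)] .
  from DERIV_add[OF this DERIV_mult[OF assms(2) pCons.IH]] show ?case
    by (simp add: pderiv_x_pCons pderiv_pCons algebra_simps)
qed

lemma poly2_eq_0_imp_eq_0:
  assumes "\<And>x y. poly2 R x y = 0"
  shows "R = 0"
proof (rule ccontr)
  assume "R \<noteq> 0"
  have "poly R [:y:] = 0" for y
    using assms by (intro poly_all_0_iff_0[THEN iffD1]) (simp add: poly2_def)
  then have "range (\<lambda>y. [:y:]) \<subseteq> {p. poly R p = 0}" by auto
  moreover have "infinite (range (\<lambda>y::complex. [:y:]))"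
    by (simp add: finite_image_iff inj_on_def infinite_UNIV_char_0)
  ultimately show False
    using poly_roots_finite[OF \<open>R \<noteq> 0\<close>] finite_subset by blast
qed

section \<open>Points of the plane as unordered triples with product 1\<close>

lemma elementary_symmetric_unit:
  fixes r s t :: complex
  assumes "r * s * t = 1"
  shows "r \<noteq> 0" "s \<noteq> 0" "t \<noteq> 0"
    and "r * s + r * t + s * t = inverse r + inverse s + inverse t"
    and "inverse r * inverse s + inverse r * inverse t + inverse s * inverse t = r + s + t"
    and "inverse r * inverse s * inverse t = 1"
proof -
  show nz: "r \<noteq> 0" "s \<noteq> 0" "t \<noteq> 0" using assms by auto
  have inv: "inverse r = s * t" "inverse s = r * t" "inverse t = r * s"
    using assms nz by (auto simp: field_simps)
  show "r * s + r * t + s * t = inverse r + inverse s + inverse t"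
    by (simp add: inv)
  have "inverse r * inverse s = t" "inverse r * inverse t = s" "inverse s * inverse t = r"
    using assms nz by (auto simp: field_simps)
  then show "inverse r * inverse s + inverse r * inverse t + inverse s * inverse t = r + s + t"
      and "inverse r * inverse s * inverse t = 1"
    using nz by simp_all
qed

lemma power_sum_unit:
  fixes r s t :: complex
  assumes "r * s * t = 1"
  shows "power_sum (r + s + t) (inverse r + inverse s + inverse t) 1 k = r ^ k + s ^ k + t ^ k"
    and "power_sum (inverse r + inverse s + inverse t) (r + s + t) 1 k =
           inverse r ^ k + inverse s ^ k + inverse t ^ k"
  using power_sum_elementary_symmetric[of r s t k]
    power_sum_elementary_symmetric[of "inverse r" "inverse s" "inverse t" k]
  by (simp_all add: elementary_symmetric_unit[OF assms] assms)

lemma cubic_root_iff: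
  fixes r s t z :: complex
  assumes "r * s * t = 1"
  shows "z ^ 3 - (r + s + t) * z\<^sup>2 + (inverse r + inverse s + inverse t) * z - 1 = 0
           \<longleftrightarrow> z \<in> {r, s, t}"
proof -
  have "z ^ 3 - (r + s + t) * z\<^sup>2 + (r * s + r * t + s * t) * z - r * s * t
      = (z - r) * (z - s) * (z - t)"
    by (simp add: algebra_simps power2_eq_square power3_eq_cube)
  then show ?thesis
    by (simp add: assms elementary_symmetric_unit[OF assms])
qed

text \<open>
  The map from triples with product 1 to the plane is onto, because every cubic splits over the
  complex numbers. Hence statements about \<open>Q_d\<close> at arbitrary complex points can be checked on triples.
\<close>
lemma exists_roots:
  fixes x y :: complex
  obtains r s t where "r * s * t = 1" "x = r + s + t" "y = inverse r + inverse s + inverse t"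
proof -
  obtain r where r: "poly [:-1, y, -x, 1:] r = 0"
    using alg_closed_imp_poly_has_root[of "[:-1, y, -x, 1:]"] by auto
  obtain s where s: "poly [:y - r * (x - r), - (x - r), 1:] s = 0"
    using alg_closed_imp_poly_has_root[of "[:y - r * (x - r), - (x - r), 1:]"] by auto
  define t where "t = x - r - s"
  have x: "x = r + s + t" by (simp add: t_def)
  have y: "y = r * s + r * t + s * t"
    using s by (simp add: t_def algebra_simps)
  have "r * s * t = 1"
    using r unfolding x y by (simp add: algebra_simps power2_eq_square)
  with that x y show ?thesis
    by (simp add: elementary_symmetric_unit)
qed

section \<open>The polynomial \<open>Q_d\<close>\<close>

definition omega :: complex where
  "omega = cis (2 * pi / 3)"

lemma omega_power: "omega ^ 3 = 1" "omega \<noteq> 0" "inverse omega = omega\<^sup>2" "omega \<noteq> 1"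
proof -
  have "omega ^ 3 = cis (2 * pi)"
    by (simp add: omega_def Complex.DeMoivre)
  then show 1: "omega ^ 3 = 1" by simp
  then show 0: "omega \<noteq> 0" by auto
  from 1 0 show "inverse omega = omega\<^sup>2"
    by (simp add: field_simps power2_eq_square power3_eq_cube)
  have "cos (2 * pi / 3) \<noteq> (1::real)"
    by (simp add: cos_120)
  then show "omega \<noteq> 1"
    by (metis Re_complex_of_real cis.sel(1) of_real_1 omega_def)
qed

lemma omega_sum: "omega\<^sup>2 + omega + 1 = 0"
proof -
  have "(omega - 1) * (omega\<^sup>2 + omega + 1) = 0"
    using omega_power(1) by (simp add: algebra_simps power2_eq_square power3_eq_cube)
  then show ?thesis using omega_power(4) by simp
qed

abbreviation poly_X :: "complex poly poly" where "poly_X \<equiv> [:[:0, 1:]:]"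
abbreviation poly_Y :: "complex poly poly" where "poly_Y \<equiv> [:0, 1:]"

text \<open>
  The explicit form of \<open>Q_d\<close>: the phases \<open>-4\<pi>/3\<close>, \<open>2\<pi>/3\<close>, \<open>2\<pi>/3\<close> in the three summands of \<open>g_1\<close> are all
  congruent to \<open>2\<pi>/3\<close>, so that \<open>g_1\<close> is \<open>omega\<close> times a power sum, and its conjugate on the torus is the
  power sum of the inverses, which exchanges \<open>x\<close> and \<open>y\<close>.
\<close>
definition folding_poly :: "nat \<Rightarrow> complex poly poly" where
  "folding_poly d = smult [:omega:] (power_sum poly_X poly_Y 1 d)
             + smult [:omega\<^sup>2:] (power_sum poly_Y poly_X 1 d)"

lemma poly2_power_sum [simp]:
  "poly2 (power_sum P Q R k) x y = power_sum (poly2 P x y) (poly2 Q x y) (poly2 R x y) k"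
  by (induction P Q R k rule: power_sum.induct) simp_all

lemma poly2_folding:
  "poly2 (folding_poly d) x y = omega * power_sum x y 1 d + omega\<^sup>2 * power_sum y x 1 d"
  by (simp add: folding_poly_def)

lemma poly2_folding_roots:
  assumes "r * s * t = 1"
  shows "poly2 (folding_poly d) (r + s + t) (inverse r + inverse s + inverse t) =
           (omega * r ^ d + inverse (omega * r ^ d)) + (omega * s ^ d + inverse (omega * s ^ d))
             + (omega * t ^ d + inverse (omega * t ^ d))"
  unfolding poly2_folding power_sum_unit[OF assms]
  by (simp add: omega_power(3) power_inverse algebra_simps)

lemma cis_triple_unit:
  "cis (- 2 * pi * u) * cis (- 2 * pi * v) * cis (2 * pi * (u + v)) = 1"
  by (simp add: cis_mult algebra_simps)

lemma poly2_folding_h: "poly2 (folding_poly d) (h1 u v) (h2 u v) = H d u v"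
proof -
  have *: "cis (- 2 * pi * (real d * u + 2 / 3)) = omega * cis (- 2 * pi * u) ^ d"
    "cis (- 2 * pi * (real d * v - 1 / 3)) = omega * cis (- 2 * pi * v) ^ d"
    "cis (2 * pi * (real d * (u + v) + 1 / 3)) = omega * cis (2 * pi * (u + v)) ^ d"
  proof -
    have "cis (- 2 * pi * (real d * u + 2 / 3)) = cis (- 2 * pi * (real d * u + 2 / 3) + 2 * pi)"
      by (simp only: cis_mult[symmetric] cis_2pi mult_1_right)
    also have "- 2 * pi * (real d * u + 2 / 3) + 2 * pi = 2 * pi / 3 + real d * (- 2 * pi * u)"
      by (simp add: algebra_simps)
    finally show "cis (- 2 * pi * (real d * u + 2 / 3)) = omega * cis (- 2 * pi * u) ^ d"
      by (simp only: omega_def Complex.DeMoivre cis_mult)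
    have "- 2 * pi * (real d * v - 1 / 3) = 2 * pi / 3 + real d * (- 2 * pi * v)"
      by (simp add: algebra_simps)
    then show "cis (- 2 * pi * (real d * v - 1 / 3)) = omega * cis (- 2 * pi * v) ^ d"
      by (simp only: omega_def Complex.DeMoivre cis_mult)
    have "2 * pi * (real d * (u + v) + 1 / 3) = 2 * pi / 3 + real d * (2 * pi * (u + v))"
      by (simp add: algebra_simps)
    then show "cis (2 * pi * (real d * (u + v) + 1 / 3)) = omega * cis (2 * pi * (u + v)) ^ d"
      by (simp only: omega_def Complex.DeMoivre cis_mult)
  qed
  have cnj: "cnj z = inverse z" if "cmod z = 1" for z
    using that complex_norm_square[of z] by (intro inverse_unique[symmetric]) simp
  define r s t where "r = cis (- 2 * pi * u)" and "s = cis (- 2 * pi * v)"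
    and "t = cis (2 * pi * (u + v))"
  note rst = this
  have unit: "r * s * t = 1"
    unfolding rst by (rule cis_triple_unit)
  have norm: "cmod r = 1" "cmod s = 1" "cmod t = 1" "cmod omega = 1"
    by (simp_all add: rst omega_def)
  have "h1 u v = r + s + t" "h2 u v = inverse r + inverse s + inverse t"
    unfolding h2_def h1_def rst[symmetric] by (simp_all add: cnj norm)
  moreover have "g1 d u v = omega * r ^ d + omega * s ^ d + omega * t ^ d"
    unfolding g1_def * rst[symmetric] ..
  moreover from this have "g2 d u v = inverse (omega * r ^ d) + inverse (omega * s ^ d)
      + inverse (omega * t ^ d)"
    by (simp add: g2_def cnj norm power_inverse)
  ultimately show ?thesis
    by (simp add: H_def poly2_folding_roots[OF unit])
qed

text \<open>
  The uniqueness of \<open>Q_d\<close>. The parametrization of the image of \<open>h\<close> extends to entire functions of each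
  angle, so vanishing for real angles continues to complex ones, first in one variable and then in the
  other; complex angles reach every point of the plane.
\<close>
lemma poly2_eq_0_on_deltoid_imp_eq_0:
  assumes "\<And>u v. poly2 R (h1 u v) (h2 u v) = 0"
  shows "R = 0"
proof (rule poly2_eq_0_imp_eq_0)
  define F where "F a b = poly2 R (exp a + exp b + exp (- a - b)) (exp (- a) + exp (- b) + exp (a + b))"
    for a b
  have real_real: "F (\<i> * of_real a) (\<i> * of_real b) = 0" for a b :: real
  proof -
    have "- 2 * pi * (- a / (2 * pi)) = a" "- 2 * pi * (- b / (2 * pi)) = b"
      "2 * pi * (- a / (2 * pi) + - b / (2 * pi)) = - a - b"
      by (simp_all add: field_simps)
    then have "h1 (- a / (2 * pi)) (- b / (2 * pi)) = cis a + cis b + cis (- a - b)"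
      by (simp only: h1_def)
    moreover from this
    have "h2 (- a / (2 * pi)) (- b / (2 * pi)) = cis (- a) + cis (- b) + cis (a + b)"
      by (simp add: h2_def cis_cnj add.commute flip: cis_inverse)
    ultimately show ?thesis
      using assms[of "- a / (2 * pi)" "- b / (2 * pi)"]
      by (simp add: F_def cis_conv_exp algebra_simps)
  qed
  \<comment> \<open>The factor \<open>\<i>\<close> turns the angles into real variables, which accumulate at 0.\<close>
  have hol: "(\<lambda>a. F (\<i> * a) b) holomorphic_on UNIV" "(\<lambda>b. F a (\<i> * b)) holomorphic_on UNIV" for a b
    unfolding F_def
    by (auto simp: holomorphic_on_def field_differentiable_def
        intro!: exI has_field_derivative_poly2 derivative_eq_intros)
  have lim: "(0::complex) islimpt \<real>"
    unfolding islimpt_approachable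
  proof (intro allI impI)
    fix e :: real
    assume "0 < e"
    then show "\<exists>z\<in>\<real>. z \<noteq> (0::complex) \<and> dist z 0 < e"
      by (intro bexI[of _ "of_real (e / 2)"]) auto
  qed
  have real_complex: "F a (\<i> * of_real b) = 0" for a b
  proof -
    have "F (\<i> * (- \<i> * a)) (\<i> * of_real b) = 0"
      by (rule analytic_continuation[OF hol(1) open_UNIV connected_UNIV _ _ lim])
        (auto simp: real_real elim!: Reals_cases)
    then show ?thesis by simp
  qed
  have all: "F a b = 0" for a b
  proof -
    have "F a (\<i> * (- \<i> * b)) = 0"
      by (rule analytic_continuation[OF hol(2) open_UNIV connected_UNIV _ _ lim])
        (auto simp: real_complex elim!: Reals_cases)
    then show ?thesis by simp
  qed
  fix x y :: complex
  obtain r s t where rst: "r * s * t = 1" "x = r + s + t" "y = inverse r + inverse s + inverse t"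
    by (rule exists_roots[of x y])
  have nz: "r \<noteq> 0" "s \<noteq> 0" using rst(1) by auto
  then have "t = inverse r * inverse s"
    using rst(1) by (simp add: field_simps)
  moreover from this have "inverse t = r * s"
    by simp
  ultimately have "exp (Ln r) + exp (Ln s) + exp (- Ln r - Ln s) = x"
    "exp (- Ln r) + exp (- Ln s) + exp (Ln r + Ln s) = y"
    using nz by (simp_all add: rst exp_add exp_diff exp_minus divide_inverse)
  with all[of "Ln r" "Ln s"] show "poly2 R x y = 0"
    by (simp add: F_def)
qed

lemma Q_poly_eq_folding: "Q_poly d = folding_poly d"
  unfolding Q_poly_def
proof (rule the_equality)
  show "\<forall>u v. poly2 (folding_poly d) (h1 u v) (h2 u v) = H d u v"
    by (simp add: poly2_folding_h)
next
  fix Q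
  assume "\<forall>u v. poly2 Q (h1 u v) (h2 u v) = H d u v"
  then have "Q - folding_poly d = 0"
    by (intro poly2_eq_0_on_deltoid_imp_eq_0) (simp add: poly2_folding_h)
  then show "Q = folding_poly d" by simp
qed

section \<open>The first two derivatives of \<open>Q_d\<close> in logarithmic coordinates\<close>

text \<open>
  With \<open>omega * t ^ d = exp a\<close>, these are \<open>2 sinh a\<close> and \<open>2 cosh a\<close>: the pullback of \<open>Q_d\<close> is a sum of three
  values of \<open>2 cosh\<close>, whose derivative in the coordinate \<open>a\<close> is \<open>2 sinh a\<close>.
\<close>
definition two_sinh :: "nat \<Rightarrow> complex \<Rightarrow> complex" where
  "two_sinh d t = omega * t ^ d - inverse (omega * t ^ d)"

definition two_cosh :: "nat \<Rightarrow> complex \<Rightarrow> complex" where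
  "two_cosh d t = omega * t ^ d + inverse (omega * t ^ d)"

text \<open>
  The derivative of \<open>Q_d\<close> along the one-parameter subgroup
  \<open>(r * exp (k * \<tau>), s * exp (l * \<tau>), t * exp (m * \<tau>))\<close>; the condition \<open>k + l + m = 0\<close> keeps the product equal
  to 1.
\<close>
lemma folding_first_order:
  fixes k l m :: complex
  assumes unit: "r * s * t = 1" and dir: "k + l + m = 0"
  defines "x \<equiv> r + s + t" and "y \<equiv> inverse r + inverse s + inverse t"
  shows "poly2 (pderiv_x (folding_poly d)) x y * (k * r + l * s + m * t)
       - poly2 (pderiv (folding_poly d)) x y * (k * inverse r + l * inverse s + m * inverse t)
       = of_nat d * (k * two_sinh d r + l * two_sinh d s + m * two_sinh d t)"
proof -
  note nz = elementary_symmetric_unit(1-3)[OF unit]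
  define c where "c \<tau> a q = q * exp (a * \<tau>)" for \<tau> a q :: complex
  define X where "X \<tau> = c \<tau> k r + c \<tau> l s + c \<tau> m t" for \<tau>
  define Y where "Y \<tau> = inverse (c \<tau> k r) + inverse (c \<tau> l s) + inverse (c \<tau> m t)" for \<tau>
  have c0: "c 0 a q = q" for a q by (simp add: c_def)
  have cnz: "c \<tau> a q \<noteq> 0" if "q \<noteq> 0" for \<tau> a q using that by (simp add: c_def)
  have dc: "((\<lambda>\<tau>. c \<tau> a q) has_field_derivative a * q) (at 0)" for a q
    unfolding c_def by (auto intro!: derivative_eq_intros)
  have dic: "((\<lambda>\<tau>. inverse (c \<tau> a q)) has_field_derivative - (a * inverse q)) (at 0)" if "q \<noteq> 0" for a q
    unfolding c_def using that
    by (auto intro!: derivative_eq_intros simp: field_simps)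
  have unit': "c \<tau> k r * c \<tau> l s * c \<tau> m t = 1" for \<tau>
  proof -
    have "c \<tau> k r * c \<tau> l s * c \<tau> m t = (r * s * t) * exp ((k + l + m) * \<tau>)"
      by (simp add: c_def exp_add algebra_simps)
    then show ?thesis by (simp add: unit dir)
  qed
  have dX: "(X has_field_derivative k * r + l * s + m * t) (at 0)"
    unfolding X_def by (auto intro!: derivative_eq_intros dc)
  have dY: "(Y has_field_derivative - (k * inverse r + l * inverse s + m * inverse t)) (at 0)"
    unfolding Y_def by (rule DERIV_cong[OF DERIV_add[OF DERIV_add[OF dic dic] dic]]) (simp_all add: nz)
  have d1: "((\<lambda>\<tau>. omega * c \<tau> a q ^ d + inverse (omega * c \<tau> a q ^ d))
      has_field_derivative of_nat d * (a * two_sinh d q)) (at 0)" if "q \<noteq> 0" for a q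
  proof -
    have "omega * c \<tau> a q ^ d = omega * q ^ d * exp (of_nat d * a * \<tau>)" for \<tau>
      by (simp add: c_def power_mult_distrib flip: exp_of_nat_mult) (simp add: algebra_simps)
    moreover have "((\<lambda>\<tau>. omega * q ^ d * exp (of_nat d * a * \<tau>)
         + inverse (omega * q ^ d * exp (of_nat d * a * \<tau>)))
        has_field_derivative of_nat d * (a * two_sinh d q)) (at 0)"
      using that omega_power(2) unfolding two_sinh_def
      by (auto intro!: derivative_eq_intros simp: field_simps power2_eq_square)
    ultimately show ?thesis by (simp only:)
  qed
  have "((\<lambda>\<tau>. poly2 (folding_poly d) (X \<tau>) (Y \<tau>)) has_field_derivative
      of_nat d * (k * two_sinh d r) + of_nat d * (l * two_sinh d s) + of_nat d * (m * two_sinh d t)) (at 0)"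
    unfolding X_def Y_def poly2_folding_roots[OF unit']
    by (intro DERIV_add d1 nz)
  moreover have "X 0 = x" "Y 0 = y" by (simp_all add: X_def Y_def x_def y_def c0)
  ultimately show ?thesis
    using DERIV_unique[OF has_field_derivative_poly2[OF dX dY, of "folding_poly d"]]
    by (simp add: algebra_simps)
qed

text \<open>
  Differentiating the first-order identity along a second one-parameter subgroup. At a critical point
  the terms with second derivatives of the coordinates drop out, so that the Hessian of \<open>Q_d\<close> pulls
  back to the diagonal form with entries \<open>2 cosh\<close>. This holds also where two of \<open>r\<close>, \<open>s\<close>, \<open>t\<close> coincide and
  the parametrization is not a local coordinate system.
\<close>
lemma folding_second_order:
  fixes k l m k' l' m' :: complex
  assumes unit: "r * s * t = 1" and dir: "k + l + m = 0" and dir': "k' + l' + m' = 0"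
  defines "x \<equiv> r + s + t" and "y \<equiv> inverse r + inverse s + inverse t"
  assumes crit: "poly2 (pderiv_x (folding_poly d)) x y = 0" "poly2 (pderiv (folding_poly d)) x y = 0"
  defines "X \<equiv> k * r + l * s + m * t" and "X' \<equiv> k' * r + l' * s + m' * t"
    and "Y \<equiv> k * inverse r + l * inverse s + m * inverse t"
    and "Y' \<equiv> k' * inverse r + l' * inverse s + m' * inverse t"
  shows "poly2 (pderiv_x (pderiv_x (folding_poly d))) x y * X * X'
       - poly2 (pderiv_x (pderiv (folding_poly d))) x y * (X * Y' + Y * X')
       + poly2 (pderiv (pderiv (folding_poly d))) x y * Y * Y'
       = (of_nat d)\<^sup>2 * (k * k' * two_cosh d r + l * l' * two_cosh d s + m * m' * two_cosh d t)"
proof -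
  note nz = elementary_symmetric_unit(1-3)[OF unit]
  define c where "c \<tau> a q = q * exp (a * \<tau>)" for \<tau> a q :: complex
  define X1 where "X1 \<tau> = c \<tau> k' r + c \<tau> l' s + c \<tau> m' t" for \<tau>
  define Y1 where "Y1 \<tau> = inverse (c \<tau> k' r) + inverse (c \<tau> l' s) + inverse (c \<tau> m' t)" for \<tau>
  define X2 where "X2 \<tau> = k * c \<tau> k' r + l * c \<tau> l' s + m * c \<tau> m' t" for \<tau>
  define Y2 where "Y2 \<tau> = k * inverse (c \<tau> k' r) + l * inverse (c \<tau> l' s) + m * inverse (c \<tau> m' t)" for \<tau>
  have c0: "c 0 a q = q" for a q by (simp add: c_def)
  have dc: "((\<lambda>\<tau>. c \<tau> a q) has_field_derivative a * q) (at 0)" for a q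
    unfolding c_def by (auto intro!: derivative_eq_intros)
  have dic: "((\<lambda>\<tau>. inverse (c \<tau> a q)) has_field_derivative - (a * inverse q)) (at 0)" if "q \<noteq> 0" for a q
    unfolding c_def using that
    by (auto intro!: derivative_eq_intros simp: field_simps)
  have unit': "c \<tau> k' r * c \<tau> l' s * c \<tau> m' t = 1" for \<tau>
  proof -
    have "c \<tau> k' r * c \<tau> l' s * c \<tau> m' t = (r * s * t) * exp ((k' + l' + m') * \<tau>)"
      by (simp add: c_def exp_add algebra_simps)
    then show ?thesis by (simp add: unit dir')
  qed
  have dX1: "(X1 has_field_derivative X') (at 0)"
    unfolding X1_def X'_def by (auto intro!: derivative_eq_intros dc)
  have dY1: "(Y1 has_field_derivative - Y') (at 0)"
    unfolding Y1_def Y'_def by (rule DERIV_cong[OF DERIV_add[OF DERIV_add[OF dic dic] dic]]) (simp_all add: nz)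
  have dX2: "(X2 has_field_derivative k * (k' * r) + l * (l' * s) + m * (m' * t)) (at 0)"
    unfolding X2_def by (intro DERIV_add DERIV_cmult dc)
  have dY2: "(Y2 has_field_derivative
      k * - (k' * inverse r) + l * - (l' * inverse s) + m * - (m' * inverse t)) (at 0)"
    unfolding Y2_def by (intro DERIV_add DERIV_cmult dic nz)
  have d1: "((\<lambda>\<tau>. two_sinh d (c \<tau> a q)) has_field_derivative of_nat d * (a * two_cosh d q)) (at 0)"
    if "q \<noteq> 0" for a q
  proof -
    have "omega * c \<tau> a q ^ d = omega * q ^ d * exp (of_nat d * a * \<tau>)" for \<tau>
      by (simp add: c_def power_mult_distrib flip: exp_of_nat_mult) (simp add: algebra_simps)
    moreover have "((\<lambda>\<tau>. omega * q ^ d * exp (of_nat d * a * \<tau>)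
         - inverse (omega * q ^ d * exp (of_nat d * a * \<tau>)))
        has_field_derivative of_nat d * (a * two_cosh d q)) (at 0)"
      using that omega_power(2) unfolding two_cosh_def
      by (auto intro!: derivative_eq_intros simp: field_simps power2_eq_square)
    ultimately show ?thesis unfolding two_sinh_def by (simp only:)
  qed
  have at0: "X1 0 = x" "Y1 0 = y" "X2 0 = X" "Y2 0 = Y"
    by (simp_all add: X1_def Y1_def x_def y_def X2_def Y2_def X_def Y_def c0)
  define xx xy yy where "xx = poly2 (pderiv_x (pderiv_x (folding_poly d))) x y"
    and "xy = poly2 (pderiv_x (pderiv (folding_poly d))) x y"
    and "yy = poly2 (pderiv (pderiv (folding_poly d))) x y"
  have "((\<lambda>\<tau>. poly2 (pderiv_x (folding_poly d)) (X1 \<tau>) (Y1 \<tau>) * X2 \<tau>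
        - poly2 (pderiv (folding_poly d)) (X1 \<tau>) (Y1 \<tau>) * Y2 \<tau>)
      has_field_derivative (xx * X' + xy * - Y') * X - (xy * X' + yy * - Y') * Y) (at 0)"
    by (rule DERIV_cong[OF DERIV_diff[OF
            DERIV_mult[OF has_field_derivative_poly2[OF dX1 dY1] dX2]
            DERIV_mult[OF has_field_derivative_poly2[OF dX1 dY1] dY2]]])
      (simp add: at0 crit xx_def xy_def yy_def pderiv_x_pderiv)
  moreover have "((\<lambda>\<tau>. poly2 (pderiv_x (folding_poly d)) (X1 \<tau>) (Y1 \<tau>) * X2 \<tau>
        - poly2 (pderiv (folding_poly d)) (X1 \<tau>) (Y1 \<tau>) * Y2 \<tau>)
      has_field_derivative of_nat d * (k * (of_nat d * (k' * two_cosh d r))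
        + l * (of_nat d * (l' * two_cosh d s)) + m * (of_nat d * (m' * two_cosh d t)))) (at 0)"
    unfolding X1_def Y1_def X2_def Y2_def folding_first_order[OF unit' dir]
    by (intro DERIV_add DERIV_cmult d1 nz)
  ultimately have "(xx * X' + xy * - Y') * X - (xy * X' + yy * - Y') * Y
     = of_nat d * (k * (of_nat d * (k' * two_cosh d r))
        + l * (of_nat d * (l' * two_cosh d s)) + m * (of_nat d * (m' * two_cosh d t)))"
    by (rule DERIV_unique)
  then show ?thesis
    unfolding xx_def[symmetric] xy_def[symmetric] yy_def[symmetric]
    by (simp add: algebra_simps power2_eq_square)
qed

section \<open>Critical points of \<open>Q_d\<close>\<close>

lemma cube_root_unity_cases:
  assumes "z ^ 3 = 1"
  shows "z = 1 \<or> z = omega \<or> z = omega\<^sup>2"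
proof -
  have "(z - 1) * (z - omega) * (z - omega\<^sup>2)
      = z ^ 3 - (omega\<^sup>2 + omega + 1) * z\<^sup>2 + (omega ^ 3 + omega\<^sup>2 + omega) * z - omega ^ 3"
    by (simp add: algebra_simps power2_eq_square power3_eq_cube)
  also have "\<dots> = 0"
    using omega_sum assms by (simp add: omega_power(1) add.commute add.left_commute)
  finally show ?thesis by simp
qed

text \<open>
  Equality of two values of \<open>z - inverse z\<close> forces \<open>a = b\<close> or \<open>a * b = - 1\<close>; in the second case the third
  number is \<open>- 1\<close> by the product condition, its value of \<open>z - inverse z\<close> is 0, and the other two are
  \<open>1\<close> and \<open>- 1\<close>.
\<close>
lemma torus_critical_cases:
  fixes R S T :: complex
  assumes unit: "R * S * T = 1"
    and eq: "R - inverse R = S - inverse S" "S - inverse S = T - inverse T"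
  shows "(R = S \<and> S = T \<and> R ^ 3 = 1) \<or> (R, S, T) \<in> {(- 1, - 1, 1), (- 1, 1, - 1), (1, - 1, - 1)}"
proof -
  note nz = elementary_symmetric_unit(1-3)[OF unit]
  have split: "a = b \<or> a * b = - 1" if "a \<noteq> 0" "b \<noteq> 0" "a - inverse a = b - inverse b" for a b :: complex
  proof -
    have "(a - b) * (a * b + 1) = a * b * ((a - inverse a) - (b - inverse b))"
      using that(1,2) by (simp add: field_simps)
    also have "\<dots> = 0" using that(3) by simp
    finally show ?thesis by (simp add: add_eq_0_iff2)
  qed
  have sign: "a = 1 \<or> a = - 1" if "a * b = - 1" "a - inverse a = 0" for a b :: complex
  proof -
    have "a \<noteq> 0" using that(1) by auto
    then have "a * a = 1" using that(2) by (simp add: field_simps)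
    then show ?thesis by (simp add: square_eq_1_iff)
  qed
  consider "R = S" "S = T" | "R * S = - 1" | "R * T = - 1" | "S * T = - 1"
    using split[OF nz(1,2) eq(1)] split[OF nz(2,3) eq(2)] by blast
  then show ?thesis
  proof cases
    case 1
    with unit show ?thesis by (simp add: power3_eq_cube)
  next
    case 2
    with unit have T: "T = - 1" by (simp add: minus_equation_iff)
    with eq have "R - inverse R = 0" by simp
    from sign[OF 2 this] 2 T show ?thesis by (auto simp: minus_equation_iff)
  next
    case 3
    from unit have "(R * T) * S = 1" by (simp add: mult_ac)
    with 3 have S: "S = - 1" by (simp add: minus_equation_iff)
    with eq have "R - inverse R = 0" by simp
    from sign[OF 3 this] 3 S show ?thesis by (auto simp: minus_equation_iff)
  next
    case 4
    from unit have "(S * T) * R = 1" by (simp add: mult_ac)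
    with 4 have R: "R = - 1" by (simp add: minus_equation_iff)
    with eq have "S - inverse S = 0" by simp
    from sign[OF 4 this] 4 R show ?thesis by (auto simp: minus_equation_iff)
  qed
qed

lemma cube_root_unity_plus_inverse:
  "omega + inverse omega = - 1" "omega\<^sup>2 + inverse (omega\<^sup>2) = - 1"
proof -
  have "inverse (omega\<^sup>2) = omega"
    by (metis omega_power(3) inverse_inverse_eq)
  with omega_sum show "omega + inverse omega = - 1" "omega\<^sup>2 + inverse (omega\<^sup>2) = - 1"
    by (simp_all add: omega_power(3) eq_neg_iff_add_eq_0 algebra_simps)
qed

text \<open>
  The expression is the determinant of the form \<open>c R * k\<^sup>2 + c S * l\<^sup>2 + c T * m\<^sup>2\<close> on the plane
  \<open>k + l + m = 0\<close>; it takes the values 12, 3 and -4 in the cases found above.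
\<close>
lemma torus_hessian_nonzero:
  fixes R S T :: complex
  assumes "R * S * T = 1" "R - inverse R = S - inverse S" "S - inverse S = T - inverse T"
  defines "c \<equiv> \<lambda>z. z + inverse z"
  shows "c R * c S + c R * c T + c S * c T \<noteq> 0"
  using torus_critical_cases[OF assms(1-3)]
proof (elim disjE conjE)
  assume "R = S" "S = T" "R ^ 3 = 1"
  with cube_root_unity_cases[of R] cube_root_unity_plus_inverse show ?thesis
    by (auto simp: c_def)
qed (auto simp: c_def)

lemma twisted_unit:
  assumes "r * s * t = 1"
  shows "(omega * r ^ d) * (omega * s ^ d) * (omega * t ^ d) = 1"
proof -
  have "(omega * r ^ d) * (omega * s ^ d) * (omega * t ^ d) = omega ^ 3 * (r * s * t) ^ d"
    by (simp add: power_mult_distrib power3_eq_cube mult_ac)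
  then show ?thesis by (simp add: assms omega_power(1))
qed

text \<open>
  Comparing determinants of the pulled-back Hessian gives (Hessian determinant of \<open>Q_d\<close>) times
  (Jacobian squared) on one side and a nonzero number on the other. So one computation yields both that
  a critical point comes from three distinct numbers and that it is non-degenerate.
\<close>
lemma critical_point_imp:
  assumes unit: "r * s * t = 1" and d: "d > 0"
  defines "x \<equiv> r + s + t" and "y \<equiv> inverse r + inverse s + inverse t"
  assumes crit: "poly2 (pderiv_x (folding_poly d)) x y = 0" "poly2 (pderiv (folding_poly d)) x y = 0"
  shows "two_sinh d r = two_sinh d s" "two_sinh d s = two_sinh d t" "r \<noteq> s" "r \<noteq> t" "s \<noteq> t"
    and "poly2 (pderiv_x (pderiv_x (folding_poly d))) x y * poly2 (pderiv (pderiv (folding_poly d))) x y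
           \<noteq> (poly2 (pderiv_x (pderiv (folding_poly d))) x y)\<^sup>2"
proof -
  show dc: "two_sinh d r = two_sinh d s" "two_sinh d s = two_sinh d t"
    using folding_first_order[OF unit, of 1 "- 1" 0 d] folding_first_order[OF unit, of 0 1 "- 1" d]
      crit d unfolding x_def y_def by auto
  \<comment> \<open>The two coordinate directions \<open>(1, 0, -1)\<close> and \<open>(0, 1, -1)\<close> of the plane \<open>k + l + m = 0\<close>.\<close>
  define X X' Y Y' where "X = r - t" and "X' = s - t" and "Y = inverse r - inverse t"
    and "Y' = inverse s - inverse t"
  note XY = this
  define xx xy yy where "xx = poly2 (pderiv_x (pderiv_x (folding_poly d))) x y"
    and "xy = poly2 (pderiv_x (pderiv (folding_poly d))) x y"
    and "yy = poly2 (pderiv (pderiv (folding_poly d))) x y"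
  note second = folding_second_order[OF unit _ _ crit[unfolded x_def y_def],
      folded x_def y_def, folded xx_def xy_def yy_def]
  define D where "D = (of_nat d :: complex)\<^sup>2"
  have "xx * X * X - xy * (X * Y + Y * X) + yy * Y * Y = D * (two_cosh d r + two_cosh d t)"
    using second[of 1 0 "- 1" 1 0 "- 1"] by (simp add: XY D_def)
  moreover have "xx * X * X' - xy * (X * Y' + Y * X') + yy * Y * Y' = D * two_cosh d t"
    using second[of 1 0 "- 1" 0 1 "- 1"] by (simp add: XY D_def)
  moreover have "xx * X' * X' - xy * (X' * Y' + Y' * X') + yy * Y' * Y' = D * (two_cosh d s + two_cosh d t)"
    using second[of 0 1 "- 1" 0 1 "- 1"] by (simp add: XY D_def)
  moreover have "(xx * X * X - xy * (X * Y + Y * X) + yy * Y * Y)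
      * (xx * X' * X' - xy * (X' * Y' + Y' * X') + yy * Y' * Y')
      - (xx * X * X' - xy * (X * Y' + Y * X') + yy * Y * Y')\<^sup>2
      = (xx * yy - xy\<^sup>2) * (X * Y' - X' * Y)\<^sup>2"
    by (simp add: algebra_simps power2_eq_square)
  ultimately have "(xx * yy - xy\<^sup>2) * (X * Y' - X' * Y)\<^sup>2
      = D\<^sup>2 * (two_cosh d r * two_cosh d s + two_cosh d r * two_cosh d t + two_cosh d s * two_cosh d t)"
    by (simp add: algebra_simps power2_eq_square)
  moreover have "two_cosh d r * two_cosh d s + two_cosh d r * two_cosh d t + two_cosh d s * two_cosh d t \<noteq> 0"
    using torus_hessian_nonzero[OF twisted_unit[OF unit, of d]] dc
    unfolding two_sinh_def two_cosh_def by blast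
  ultimately have "(xx * yy - xy\<^sup>2) * (X * Y' - X' * Y)\<^sup>2 \<noteq> 0"
    using d by (simp add: D_def)
  then have hess: "xx * yy \<noteq> xy\<^sup>2" and jac: "X * Y' - X' * Y \<noteq> 0"
    by auto
  from hess show "xx * yy \<noteq> xy\<^sup>2" .
  from jac show "r \<noteq> s" "r \<noteq> t" "s \<noteq> t"
    by (auto simp: XY)
qed

lemma critical_pointI:
  assumes unit: "r * s * t = 1" and dc: "two_sinh d r = two_sinh d s" "two_sinh d s = two_sinh d t"
    and dist: "r \<noteq> s" "r \<noteq> t" "s \<noteq> t"
  defines "x \<equiv> r + s + t" and "y \<equiv> inverse r + inverse s + inverse t"
  shows "poly2 (pderiv_x (folding_poly d)) x y = 0" "poly2 (pderiv (folding_poly d)) x y = 0"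
proof -
  define p q where "p = poly2 (pderiv_x (folding_poly d)) x y"
    and "q = poly2 (pderiv (folding_poly d)) x y"
  have inv: "inverse r = s * t" "inverse s = r * t" "inverse t = r * s"
    using unit elementary_symmetric_unit(1-3)[OF unit] by (auto simp: field_simps)
  have "(r - t) * (p + s * q) = 0"
    using folding_first_order[OF unit, of 1 0 "- 1" d] dc
    by (simp add: p_def q_def x_def y_def inv algebra_simps)
  moreover have "(s - t) * (p + r * q) = 0"
    using folding_first_order[OF unit, of 0 1 "- 1" d] dc
    by (simp add: p_def q_def x_def y_def inv algebra_simps)
  ultimately have "p + s * q = 0" "p + r * q = 0" using dist by auto
  moreover have "(r - s) * q = (p + r * q) - (p + s * q)" by (simp add: algebra_simps)
  ultimately show "p = 0" "q = 0" using dist by auto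
qed

definition crit_triples :: "nat \<Rightarrow> complex set set" where
  "crit_triples d = {A. card A = 3 \<and> \<Prod>A = 1 \<and> (\<forall>t\<in>A. \<forall>t'\<in>A. two_sinh d t = two_sinh d t')}"

definition crit_points :: "nat \<Rightarrow> (complex \<times> complex) set" where
  "crit_points d = {(x, y). poly2 (pderiv_x (folding_poly d)) x y = 0
                          \<and> poly2 (pderiv (folding_poly d)) x y = 0}"

text \<open>
  The elementary symmetric functions of a triple with product 1.
\<close>
definition plane_point :: "complex set \<Rightarrow> complex \<times> complex" where
  "plane_point A = (\<Sum>A, sum inverse A)"

lemma plane_point_triple:
  assumes "r \<noteq> s" "r \<noteq> t" "s \<noteq> t"
  shows "plane_point {r, s, t} = (r + s + t, inverse r + inverse s + inverse t)"
    "\<Prod>{r, s, t} = r * s * t"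
  using assms by (auto simp: plane_point_def add.assoc mult.assoc)

lemma inj_on_plane_point: "inj_on plane_point {A. card A = 3 \<and> \<Prod>A = 1}"
proof (rule inj_on_inverseI)
  fix A :: "complex set"
  assume "A \<in> {A. card A = 3 \<and> \<Prod>A = 1}"
  then obtain r s t where A: "A = {r, s, t}" "r \<noteq> s" "r \<noteq> t" "s \<noteq> t" and "\<Prod>A = 1"
    by (auto simp: card_3_iff)
  then have "r * s * t = 1" using plane_point_triple(2) by metis
  from cubic_root_iff[OF this]
  show "(\<lambda>(x, y). {z. z ^ 3 - x * z\<^sup>2 + y * z - 1 = 0}) (plane_point A) = A"
    unfolding A(1) plane_point_triple(1)[OF A(2-4)] by auto
qed

lemma bij_betw_crit_points:
  assumes "d > 0"
  shows "bij_betw plane_point (crit_triples d) (crit_points d)"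
proof -
  have "inj_on plane_point (crit_triples d)"
    by (rule inj_on_subset[OF inj_on_plane_point]) (auto simp: crit_triples_def)
  moreover have "plane_point A \<in> crit_points d" if "A \<in> crit_triples d" for A
  proof -
    from that obtain r s t where A: "A = {r, s, t}" "r \<noteq> s" "r \<noteq> t" "s \<noteq> t" and "\<Prod>A = 1"
      and dc: "two_sinh d r = two_sinh d s" "two_sinh d s = two_sinh d t"
      unfolding crit_triples_def by (auto simp: card_3_iff)
    then have "r * s * t = 1" using plane_point_triple(2) by metis
    from critical_pointI[OF this dc A(2-4)] show ?thesis
      unfolding A(1) plane_point_triple(1)[OF A(2-4)] by (simp add: crit_points_def)
  qed
  moreover have "(x, y) \<in> plane_point ` crit_triples d" if "(x, y) \<in> crit_points d" for x y
  proof -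
    obtain r s t where rst: "r * s * t = 1" "x = r + s + t" "y = inverse r + inverse s + inverse t"
      by (rule exists_roots[of x y])
    with that have crit: "poly2 (pderiv_x (folding_poly d)) (r + s + t) (inverse r + inverse s + inverse t) = 0"
      "poly2 (pderiv (folding_poly d)) (r + s + t) (inverse r + inverse s + inverse t) = 0"
      by (simp_all add: crit_points_def)
    note imp = critical_point_imp[OF rst(1) assms crit]
    then have "{r, s, t} \<in> crit_triples d"
      using rst(1) plane_point_triple(2)[OF imp(3-5)] by (auto simp: crit_triples_def)
    moreover have "plane_point {r, s, t} = (x, y)"
      using plane_point_triple(1)[OF imp(3-5)] rst by simp
    ultimately show ?thesis by (metis image_eqI)
  qed
  ultimately show ?thesis
    unfolding bij_betw_def by auto
qed

lemma crit_point_hessian_nonzero: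
  assumes "d > 0" "(x, y) \<in> crit_points d"
  shows "poly2 (pderiv_x (pderiv_x (folding_poly d))) x y * poly2 (pderiv (pderiv (folding_poly d))) x y
           \<noteq> (poly2 (pderiv_x (pderiv (folding_poly d))) x y)\<^sup>2"
proof -
  obtain r s t where rst: "r * s * t = 1" "x = r + s + t" "y = inverse r + inverse s + inverse t"
    by (rule exists_roots[of x y])
  with assms show ?thesis
    unfolding rst(2,3) by (intro critical_point_imp) (simp_all add: crit_points_def)
qed

lemma folding_plane_point:
  assumes "A \<in> crit_triples d"
  shows "case_prod (poly2 (folding_poly d)) (plane_point A) = sum (two_cosh d) A"
proof -
  from assms obtain r s t where A: "A = {r, s, t}" "r \<noteq> s" "r \<noteq> t" "s \<noteq> t" and "\<Prod>A = 1"
    unfolding crit_triples_def by (auto simp: card_3_iff)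
  then have "r * s * t = 1" using plane_point_triple(2) by metis
  from poly2_folding_roots[OF this, of d] show ?thesis
    unfolding A(1) plane_point_triple(1)[OF A(2-4)]
    using A by (simp add: two_cosh_def add.assoc)
qed

section \<open>Counting the critical points of given value\<close>

definition product_one_triples :: "complex set \<Rightarrow> complex set set" where
  "product_one_triples R = {A. A \<subseteq> R \<and> card A = 3 \<and> \<Prod>A = 1}"

text \<open>
  A pair \<open>(a, b)\<close> in \<open>R\<close> determines the third factor of a triple with product 1, and every triple of
  distinct numbers arises from six pairs. The pairs to be discarded form three graphs of size \<open>card R\<close>,
  any two of which meet exactly in the pairs \<open>(a, a)\<close> with \<open>a ^ 3 = 1\<close>.
\<close>
lemma card_product_one_triples:
  assumes fin: "finite R" and closed: "\<And>a b. a \<in> R \<Longrightarrow> b \<in> R \<Longrightarrow> inverse (a * b) \<in> R"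
    and nz: "0 \<notin> R"
  shows "6 * card (product_one_triples R) + 3 * card R = (card R)\<^sup>2 + 2 * card {a \<in> R. a ^ 3 = 1}"
proof -
  \<comment> \<open>The pairs whose completion to a triple with product 1 has three distinct members.\<close>
  define D where "D = {(a, b) \<in> R \<times> R. a \<noteq> b \<and> a * a * b \<noteq> 1 \<and> a * b * b \<noteq> 1}"
  define E1 E2 E3 K where "E1 = (\<lambda>a. (a, a)) ` R" and "E2 = (\<lambda>a. (a, inverse (a * a))) ` R"
    and "E3 = (\<lambda>a. (inverse (a * a), a)) ` R" and "K = (\<lambda>a. (a, a)) ` {a \<in> R. a ^ 3 = 1}"
  note E = this
  have nz': "a \<noteq> 0" if "a \<in> R" for a using that nz by auto
  have invE: "a * (a * b) = 1 \<longleftrightarrow> b = inverse (a * a)" "b * (a * a) = 1 \<longleftrightarrow> b = inverse (a * a)"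
    if "a \<in> R" for a b
    using nz'[OF that] by (auto simp: field_simps)
  have mem: "(a, b) \<in> E1 \<longleftrightarrow> a \<in> R \<and> b \<in> R \<and> a = b"
    "(a, b) \<in> E2 \<longleftrightarrow> a \<in> R \<and> b \<in> R \<and> a * a * b = 1"
    "(a, b) \<in> E3 \<longleftrightarrow> a \<in> R \<and> b \<in> R \<and> a * b * b = 1"
    "(a, b) \<in> K \<longleftrightarrow> a \<in> R \<and> b \<in> R \<and> a = b \<and> a * a * a = 1" for a b
    by (auto simp: E image_iff invE closed power3_eq_cube mult.assoc simp del: inverse_mult_distrib)
  have cardE: "card E1 = card R" "card E2 = card R" "card E3 = card R" "card K = card {a \<in> R. a ^ 3 = 1}"
    unfolding E by (auto intro!: card_image inj_onI)
  have finE: "finite E1" "finite E2" "finite E3" using fin by (simp_all add: E)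
  have K1: "E1 \<inter> E2 = K" by (auto simp: mem)
  have K2: "(E1 \<union> E2) \<inter> E3 = K"
  proof -
    have double: "a = b" if "a * a * b = 1" "a * b * b = 1" for a b :: complex
    proof -
      have "a * b * (a - b) = a * a * b - a * b * b" by (simp add: algebra_simps)
      also have "\<dots> = 0" by (simp only: that diff_self)
      finally have "a * b * (a - b) = 0" .
      moreover have "a \<noteq> 0" "b \<noteq> 0" using that(1) by auto
      ultimately show ?thesis by simp
    qed
    have "(a, b) \<in> (E1 \<union> E2) \<inter> E3 \<longleftrightarrow> (a, b) \<in> K" for a b
      unfolding Int_iff Un_iff mem using double[of a b] by auto
    then show ?thesis by auto
  qed
  have "card E1 + card E2 = card (E1 \<union> E2) + card K"
    using card_Un_Int[OF finE(1,2)] K1 by simp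
  moreover have "card (E1 \<union> E2) + card E3 = card (E1 \<union> E2 \<union> E3) + card K"
    using card_Un_Int[of "E1 \<union> E2" E3] finE K2 by simp
  moreover have "(card R)\<^sup>2 = card D + card (E1 \<union> E2 \<union> E3)"
  proof -
    have "R \<times> R = D \<union> (E1 \<union> E2 \<union> E3)" "D \<inter> (E1 \<union> E2 \<union> E3) = {}"
      by (auto simp: D_def mem)
    moreover have "finite D" using fin unfolding D_def by (auto intro: finite_subset[of _ "R \<times> R"])
    ultimately show ?thesis
      using finE fin by (metis card_Un_disjoint card_cartesian_product finite_UnI power2_eq_square)
  qed
  moreover have "card D = 6 * card (product_one_triples R)"
  proof -
    define P where "P A = {(a, b). a \<in> A \<and> b \<in> A \<and> a \<noteq> b}" for A :: "complex set"
    have P_card: "card (P A) = 6" "finite (P A)" if "card A = 3" for A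
    proof -
      have "finite A" using that by (metis card.infinite zero_neq_numeral)
      have "P A = A \<times> A - (\<lambda>a. (a, a)) ` A" by (auto simp: P_def)
      moreover have "card ((\<lambda>a. (a, a)) ` A) = 3" using that by (subst card_image) (auto intro: inj_onI)
      ultimately show "card (P A) = 6" "finite (P A)"
        using that \<open>finite A\<close> by (auto simp: card_Diff_subset image_subset_iff card_cartesian_product)
    qed
    have recover: "A = {a, b, inverse (a * b)}" if "card A = 3" "\<Prod>A = 1" "(a, b) \<in> P A" for A a b
    proof -
      have "card (A - {a, b}) = 1"
        using that by (subst card_Diff_subset) (auto simp: P_def)
      then obtain c where c: "A - {a, b} = {c}" by (rule card_1_singletonE)
      then have A: "A = {a, b, c}" "a \<noteq> b" "a \<noteq> c" "b \<noteq> c" using that(3) by (auto simp: P_def)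
      then have "a * b * c = 1" using that(2) by (simp add: mult.assoc)
      then have "inverse (a * b) = c" by (rule inverse_unique)
      with A show ?thesis by simp
    qed
    have comm: "a * a * b = a * b * a" for a b :: complex
      by (simp only: mult_ac)
    have "D = (\<Union>A\<in>product_one_triples R. P A)"
    proof (rule set_eqI, clarify)
      fix a b
      show "(a, b) \<in> D \<longleftrightarrow> (a, b) \<in> (\<Union>A\<in>product_one_triples R. P A)"
      proof
        assume D: "(a, b) \<in> D"
        define c where "c = inverse (a * b)"
        have "a * b \<noteq> 0" using D nz' by (auto simp: D_def)
        then have abc: "a * b * c = 1" unfolding c_def by (rule right_inverse)
        have ne: "a \<noteq> b" "a \<noteq> c" "b \<noteq> c"
          using D abc comm[of a b] unfolding D_def by auto
        have "{a, b, c} \<in> product_one_triples R" "(a, b) \<in> P {a, b, c}"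
          using ne D abc closed[of a b]
          by (auto simp: product_one_triples_def D_def c_def P_def mult.assoc)
        then show "(a, b) \<in> (\<Union>A\<in>product_one_triples R. P A)" by blast
      next
        assume "(a, b) \<in> (\<Union>A\<in>product_one_triples R. P A)"
        then obtain A where A: "A \<subseteq> R" "card A = 3" "\<Prod>A = 1" "(a, b) \<in> P A"
          by (auto simp: product_one_triples_def)
        from recover[OF A(2-4)] have A': "A = {a, b, inverse (a * b)}" .
        have "a \<in> R" "b \<in> R" "a \<noteq> b" using A(1,4) by (auto simp: P_def)
        moreover have "inverse (a * b) \<noteq> a" "inverse (a * b) \<noteq> b"
          using A(2) \<open>a \<noteq> b\<close> unfolding A' by (auto simp: card_insert_if split: if_splits)
        then have "a * a * b \<noteq> 1" "a * b * b \<noteq> 1"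
          using inverse_unique[of "a * b" a] inverse_unique[of "a * b" b] unfolding comm by blast+
        ultimately show "(a, b) \<in> D" by (simp add: D_def)
      qed
    qed
    also have "card \<dots> = (\<Sum>A\<in>product_one_triples R. card (P A))"
    proof (rule card_UN_disjoint)
      show "finite (product_one_triples R)"
        using fin by (auto simp: product_one_triples_def intro: finite_subset[of _ "Pow R"])
      show "\<forall>A\<in>product_one_triples R. finite (P A)"
        using P_card(2) unfolding product_one_triples_def by blast
      show "\<forall>A\<in>product_one_triples R. \<forall>B\<in>product_one_triples R. A \<noteq> B \<longrightarrow> P A \<inter> P B = {}"
      proof (intro ballI impI)
        fix A B
        assume "A \<in> product_one_triples R" "B \<in> product_one_triples R" "A \<noteq> B"
        then have "False" if "(a, b) \<in> P A" "(a, b) \<in> P B" for a b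
          using recover[of A a b] recover[of B a b] that unfolding product_one_triples_def by simp
        then show "P A \<inter> P B = {}" by auto
      qed
    qed
    also have "\<dots> = 6 * card (product_one_triples R)"
      by (simp add: product_one_triples_def P_card)
    finally show ?thesis .
  qed
  ultimately show ?thesis using cardE by linarith
qed

lemma cube_root_unity_plus_inverse_cases:
  fixes z :: complex
  assumes "z ^ 3 = 1"
  shows "z + inverse z = 2 \<or> z + inverse z = - 1"
  using cube_root_unity_cases[OF assms] cube_root_unity_plus_inverse by auto

text \<open>
  Value \<open>-3\<close> means that the common value of \<open>omega * t ^ d\<close> is a primitive cube root of unity, that is,
  \<open>omega\<close> or its square. A common value 1 would give the value 6 instead.
\<close>
lemma crit_triples_minus3:
  "{A \<in> crit_triples d. sum (two_cosh d) A = - 3}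
     = product_one_triples {t. t ^ d = 1} \<union> product_one_triples {t. t ^ d = omega}"
proof -
  have iff: "(A \<in> crit_triples d \<and> sum (two_cosh d) A = - 3)
      \<longleftrightarrow> A \<subseteq> {t. t ^ d = 1} \<or> A \<subseteq> {t. t ^ d = omega}" (is "?L \<longleftrightarrow> ?R")
    if card: "card A = 3" and prod: "\<Prod>A = 1" for A
  proof -
    obtain r s t where A: "A = {r, s, t}" "r \<noteq> s" "r \<noteq> t" "s \<noteq> t"
      using card by (auto simp: card_3_iff)
    with prod have unit: "r * s * t = 1" using plane_point_triple(2) by metis
    have sum: "sum (two_cosh d) A = two_cosh d r + (two_cosh d s + two_cosh d t)" using A by simp
    have omega_sq: "omega * z = omega\<^sup>2 \<longleftrightarrow> z = omega" for z
      using omega_power(2) by (auto simp: power2_eq_square)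
    show ?thesis
    proof
      assume L: ?L
      then have "two_sinh d r = two_sinh d s" "two_sinh d s = two_sinh d t"
        unfolding crit_triples_def A by blast+
      from torus_critical_cases[OF twisted_unit[OF unit] this[unfolded two_sinh_def]]
      consider "omega * r ^ d = omega * s ^ d" "omega * s ^ d = omega * t ^ d" "(omega * r ^ d) ^ 3 = 1"
        | "two_cosh d r + (two_cosh d s + two_cosh d t) = - 2"
        by (elim disjE conjE) (auto simp: two_cosh_def simp del: inverse_mult_distrib)
      then show ?R
      proof cases
        case 1
        then have eq: "s ^ d = r ^ d" "t ^ d = r ^ d" using omega_power(2) by auto
        then have "two_cosh d s = two_cosh d r" "two_cosh d t = two_cosh d r" by (simp_all add: two_cosh_def)
        with L sum have "two_cosh d r = - 1" by simp
        moreover have "two_cosh d r = 1 + inverse 1" if one: "omega * r ^ d = 1"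
          unfolding two_cosh_def one ..
        ultimately have "omega * r ^ d \<noteq> 1" by fastforce
        with cube_root_unity_cases[OF 1(3)] have "r ^ d = 1 \<or> r ^ d = omega"
          using omega_power(2) by (auto simp: omega_sq)
        with eq show ?thesis by (auto simp: A)
      next
        case 2
        with L sum show ?thesis by simp
      qed
    next
      assume ?R
      then have "(\<forall>z\<in>A. omega * z ^ d = omega) \<or> (\<forall>z\<in>A. omega * z ^ d = omega\<^sup>2)"
        by (auto simp: power2_eq_square)
      then obtain c where c: "\<And>z. z \<in> A \<Longrightarrow> omega * z ^ d = c" "c + inverse c = - 1"
        using cube_root_unity_plus_inverse by blast
      then have "two_cosh d z = - 1" "two_sinh d z = c - inverse c" if "z \<in> A" for z
        unfolding two_cosh_def two_sinh_def using that by (simp_all only:)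
      then show ?L
        unfolding crit_triples_def using card prod by simp
    qed
  qed
  then show ?thesis
    by (auto simp: product_one_triples_def crit_triples_def)
qed

lemma finite_product_one_triples: "finite R \<Longrightarrow> finite (product_one_triples R)"
  by (rule finite_subset[of _ "Pow R"]) (auto simp: product_one_triples_def)

text \<open>
  Since 3 divides \<open>d\<close>, all cube roots of unity solve \<open>t ^ d = 1\<close> and none solves \<open>t ^ d = omega\<close>; the two
  counts are \<open>(d\<^sup>2 - 3 * d + 6) / 6\<close> and \<open>(d\<^sup>2 - 3 * d) / 6\<close>.
\<close>
lemma card_crit_triples_minus3:
  assumes "n \<ge> 1" "d = 3 * n"
  shows "card {A \<in> crit_triples d. sum (two_cosh d) A = - 3} + d = 3 * n\<^sup>2 + 1"
proof -
  define R1 R2 where "R1 = {t::complex. t ^ d = 1}" and "R2 = {t. t ^ d = omega}"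
  have d: "d > 0" using assms by simp
  have card: "card R1 = d" "card R2 = d"
    unfolding R1_def R2_def using d omega_power(2) by (auto intro!: card_nth_roots)
  then have fin: "finite R1" "finite R2" using d by (auto intro: card_ge_0_finite)
  have K1: "{a \<in> R1. a ^ 3 = 1} = {a. a ^ 3 = 1}" and K2: "{a \<in> R2. a ^ 3 = 1} = {}"
    using omega_power(4) by (auto simp: R1_def R2_def assms power_mult)
  have K: "card {a \<in> R1. a ^ 3 = 1} = 3" "card {a \<in> R2. a ^ 3 = 1} = 0"
    unfolding K1 K2 using card_nth_roots[of 1 3] by simp_all
  have "6 * card (product_one_triples R1) + 3 * d = d\<^sup>2 + 6"
    using card_product_one_triples[OF fin(1)] d card K
    by (auto simp: R1_def power_inverse power_mult_distrib power_0_left)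
  moreover have "inverse (a * b) \<in> R2" if "a \<in> R2" "b \<in> R2" for a b
  proof -
    have "inverse omega * inverse omega = omega"
      using omega_power(1,2) by (simp add: field_simps power3_eq_cube)
    then show ?thesis using that by (simp add: R2_def power_inverse power_mult_distrib)
  qed
  then have "6 * card (product_one_triples R2) + 3 * d = d\<^sup>2"
    using card_product_one_triples[OF fin(2)] d card K omega_power(2)
    by (auto simp: R2_def power_0_left)
  moreover have "card (product_one_triples R1 \<union> product_one_triples R2)
      = card (product_one_triples R1) + card (product_one_triples R2)"
  proof (rule card_Un_disjoint)
    show "finite (product_one_triples R1)" "finite (product_one_triples R2)"
      using fin by (simp_all add: finite_product_one_triples)
    have False if "A \<in> product_one_triples R1" "A \<in> product_one_triples R2" for A
    proof -
      from that have sub: "A \<subseteq> R1" "A \<subseteq> R2" and "card A = 3"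
        by (simp_all add: product_one_triples_def)
      then obtain x where "x \<in> A" by fastforce
      with sub have "x ^ d = 1" "x ^ d = omega" unfolding R1_def R2_def by blast+
      with omega_power(4) show False by simp
    qed
    then show "product_one_triples R1 \<inter> product_one_triples R2 = {}" by blast
  qed
  moreover have "d\<^sup>2 = 9 * n\<^sup>2"
    by (simp add: assms(2) power_mult_distrib)
  ultimately have "card (product_one_triples R1 \<union> product_one_triples R2) + d = 3 * n\<^sup>2 + 1"
    using assms(2) by linarith
  then show ?thesis
    unfolding crit_triples_minus3 R1_def R2_def .
qed

text \<open>
  In a triple of value \<open>-2\<close> exactly two members satisfy \<open>omega * t ^ d = - 1\<close>, and they determine the
  third. Any two of the \<open>d\<close> solutions may occur, whence the binomial coefficient.
\<close>
lemma card_crit_triples_minus2: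
  assumes "d > 0"
  shows "card {A \<in> crit_triples d. sum (two_cosh d) A = - 2} = d choose 2"
proof -
  define N where "N = {t. omega * t ^ d = - 1}"
  define F where "F = {A \<in> crit_triples d. sum (two_cosh d) A = - 2}"
  define third where "third B = insert (inverse (\<Prod>B)) B" for B :: "complex set"
  have "omega * z = - 1 \<longleftrightarrow> z = - inverse omega" for z
    using omega_power(2) by (auto simp: field_simps)
  then have "N = {t. t ^ d = - (omega\<^sup>2)}"
    by (simp add: N_def omega_power(3))
  then have cardN: "card N = d"
    using assms omega_power(2) by (simp add: card_nth_roots)
  then have finN: "finite N" using assms by (auto intro: card_ge_0_finite)
  have shape: "\<exists>r s t. A = {r, s, t} \<and> r \<noteq> s \<and> r \<in> N \<and> s \<in> N \<and> t \<notin> N \<and> r * s * t = 1"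
    if "A \<in> F" for A
  proof -
    from that have card: "card A = 3" and prod: "\<Prod>A = 1" and val: "sum (two_cosh d) A = - 2"
      by (auto simp: F_def crit_triples_def)
    obtain r s t where A: "A = {r, s, t}" "r \<noteq> s" "r \<noteq> t" "s \<noteq> t"
      using card by (auto simp: card_3_iff)
    with prod have unit: "r * s * t = 1" using plane_point_triple(2) by metis
    have sum: "sum (two_cosh d) A = two_cosh d r + (two_cosh d s + two_cosh d t)" using A by simp
    have "two_sinh d r = two_sinh d s" "two_sinh d s = two_sinh d t"
      using that unfolding crit_triples_def A F_def by blast+
    from torus_critical_cases[OF twisted_unit[OF unit] this[unfolded two_sinh_def]]
    consider "omega * r ^ d = omega * s ^ d" "omega * s ^ d = omega * t ^ d" "(omega * r ^ d) ^ 3 = 1"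
      | "r \<in> N" "s \<in> N" "t \<notin> N" | "r \<in> N" "s \<notin> N" "t \<in> N" | "r \<notin> N" "s \<in> N" "t \<in> N"
      by (elim disjE conjE) (auto simp: N_def)
    then show ?thesis
    proof cases
      case 1
      then have "two_cosh d s = two_cosh d r" "two_cosh d t = two_cosh d r"
        by (simp_all only: two_cosh_def)
      with val sum have "3 * two_cosh d r = - 2" by simp
      moreover have "two_cosh d r = 2 \<or> two_cosh d r = - 1"
        unfolding two_cosh_def by (rule cube_root_unity_plus_inverse_cases[OF 1(3)])
      ultimately show ?thesis by auto
    next
      case 2
      with A unit show ?thesis by blast
    next
      case 3
      have "A = {r, t, s}" "r * t * s = 1" using A unit by (auto simp: mult_ac)
      with 3 A show ?thesis by blast
    next
      case 4
      have "A = {s, t, r}" "s * t * r = 1" using A unit by (auto simp: mult_ac)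
      with 4 A show ?thesis by blast
    qed
  qed
  have "bij_betw (\<lambda>A. A \<inter> N) F {B. B \<subseteq> N \<and> card B = 2}"
  proof (rule bij_betw_byWitness[where f' = third])
    show "\<forall>A\<in>F. third (A \<inter> N) = A"
    proof
      fix A assume "A \<in> F"
      then obtain r s t where A: "A = {r, s, t}" "r \<noteq> s" "r \<in> N" "s \<in> N" "t \<notin> N" "r * s * t = 1"
        using shape by blast
      then have "A \<inter> N = {r, s}" by auto
      moreover have "inverse (r * s) = t" by (rule inverse_unique) (rule A)
      ultimately show "third (A \<inter> N) = A" using A by (auto simp: third_def)
    qed
    show "(\<lambda>A. A \<inter> N) ` F \<subseteq> {B. B \<subseteq> N \<and> card B = 2}"
    proof clarify
      fix A assume "A \<in> F"
      then obtain r s t where A: "A = {r, s, t}" "r \<noteq> s" "r \<in> N" "s \<in> N" "t \<notin> N"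
        using shape by blast
      then have "A \<inter> N = {r, s}" by auto
      with A show "A \<inter> N \<subseteq> N \<and> card (A \<inter> N) = 2" by auto
    qed
    have *: "third B \<inter> N = B \<and> third B \<in> F" if sub: "B \<subseteq> N" and two: "card B = 2" for B
    proof -
      obtain r s where B: "B = {r, s}" "r \<noteq> s" using two by (auto simp: card_2_iff)
      with sub have rs: "omega * r ^ d = - 1" "omega * s ^ d = - 1" by (auto simp: N_def)
      then have "r \<noteq> 0" "s \<noteq> 0" using assms by (auto simp: power_0_left)
      define t where "t = inverse (r * s)"
      have unit: "r * s * t = 1"
        unfolding t_def by (rule right_inverse) (simp add: \<open>r \<noteq> 0\<close> \<open>s \<noteq> 0\<close>)
      from twisted_unit[OF this, of d] have t: "omega * t ^ d = 1" by (simp add: rs)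
      have ne: "r \<noteq> t" "s \<noteq> t" using rs t by auto
      have "third B = {r, s, t}" using B by (auto simp: third_def t_def)
      moreover have "{r, s, t} \<inter> N = {r, s}" using rs t by (auto simp: N_def)
      moreover have "{r, s, t} \<in> F"
      proof -
        have "two_sinh d r = 0" "two_sinh d s = 0" "two_sinh d t = 0"
          unfolding two_sinh_def rs t by simp_all
        moreover have "two_cosh d r = - 2" "two_cosh d s = - 2" "two_cosh d t = 2"
          unfolding two_cosh_def rs t by simp_all
        moreover have "card {r, s, t} = 3" "\<Prod>{r, s, t} = 1"
          using B(2) ne plane_point_triple(2)[OF B(2) ne] unit by simp_all
        ultimately show ?thesis
          using B(2) ne by (simp add: F_def crit_triples_def)
      qed
      ultimately show ?thesis using B by simp
    qed
    show "\<forall>B\<in>{B. B \<subseteq> N \<and> card B = 2}. third B \<inter> N = B"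
      and "third ` {B. B \<subseteq> N \<and> card B = 2} \<subseteq> F"
      using * by auto
  qed
  then have "card F = card {B. B \<subseteq> N \<and> card B = 2}"
    by (rule bij_betw_same_card)
  also have "\<dots> = d choose 2"
    by (simp add: n_subsets[OF finN] cardN)
  finally show ?thesis by (simp add: F_def)
qed

section \<open>Chebyshev polynomials\<close>

text \<open>
  The parameter \<open>m\<close>, which is 1 for the Chebyshev polynomial itself, becomes \<open>z\<^sup>2\<close> in its homogenization.
\<close>
fun cheb :: "'a::comm_ring_1 \<Rightarrow> 'a \<Rightarrow> nat \<Rightarrow> 'a" where
  "cheb w m 0 = 1"
| "cheb w m (Suc 0) = w"
| "cheb w m (Suc (Suc k)) = 2 * w * cheb w m (Suc k) - m * cheb w m k"

lemma cheb_scale: "cheb (z * w) (z\<^sup>2 * m) k = z ^ k * cheb w m k"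
  by (induction w m k rule: cheb.induct) (simp_all add: algebra_simps power2_eq_square)

lemma cheb_leading: "cheb w 0 (Suc k) = 2 ^ k * w ^ Suc k"
  by (induction k) simp_all

lemma poly_cheb [simp]: "poly (cheb p q k) w = cheb (poly p w) (poly q w) k"
  by (induction p q k rule: cheb.induct) simp_all

lemma cheb_cos: "cheb (cos \<theta>) 1 k = cos (of_nat k * \<theta>)" for \<theta> :: complex
proof (induction "cos \<theta>" "1 :: complex" k rule: cheb.induct)
  case (3 k)
  have "cos (of_nat (Suc (Suc k)) * \<theta>) = cos (of_nat (Suc k) * \<theta> + \<theta>)"
    by (simp add: algebra_simps)
  moreover have "cos (of_nat k * \<theta>) = cos (of_nat (Suc k) * \<theta> - \<theta>)"
    by (simp add: algebra_simps)
  ultimately show ?case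
    using 3 by (simp add: cos_add cos_diff)
qed simp_all

lemma chebyshev_eq: "chebyshev d = cheb [:0, 1:] 1 d"
  unfolding chebyshev_def
proof (rule the_equality)
  show *: "\<forall>\<theta>::real. poly (cheb [:0, 1:] 1 d) (of_real (cos \<theta>)) = complex_of_real (cos (real d * \<theta>))"
  proof
    fix \<theta> :: real
    have "of_nat d * of_real \<theta> = complex_of_real (real d * \<theta>)" by simp
    with cheb_cos[of "of_real \<theta>" d]
    show "poly (cheb [:0, 1:] 1 d) (of_real (cos \<theta>)) = complex_of_real (cos (real d * \<theta>))"
      by (simp only: cos_of_real poly_cheb) simp
  qed
  fix p :: "complex poly"
  assume p: "\<forall>\<theta>. poly p (of_real (cos \<theta>)) = of_real (cos (real d * \<theta>))"
  show "p = cheb [:0, 1:] 1 d"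
  proof (rule ccontr)
    assume "p \<noteq> cheb [:0, 1:] 1 d"
    then have "finite {w. poly (p - cheb [:0, 1:] 1 d) w = 0}"
      by (intro poly_roots_finite) simp
    moreover have "of_real ` {-1..1} \<subseteq> {w. poly (p - cheb [:0, 1:] 1 d) w = 0}"
    proof clarify
      fix a :: real assume "a \<in> {-1..1}"
      then have "a = cos (arccos a)" by simp
      then show "poly (p - cheb [:0, 1:] 1 d) (of_real a) = 0"
        using p * by (metis poly_diff diff_self)
    qed
    ultimately have "finite (complex_of_real ` {-1..1})" by (rule rev_finite_subset)
    then show False
      using infinite_Icc[of "- 1" "1 :: real"] by (simp add: finite_image_iff inj_on_def)
  qed
qed

lemma chebyshev_cos: "poly (chebyshev d) (cos \<theta>) = cos (of_nat d * \<theta>)"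
  by (simp add: chebyshev_eq cheb_cos)

lemma chebyshev_first_order:
  "poly (pderiv (chebyshev d)) (cos \<theta>) * sin \<theta> = of_nat d * sin (of_nat d * \<theta>)"
proof -
  have "((\<lambda>\<theta>. poly (chebyshev d) (cos \<theta>)) has_field_derivative
      poly (pderiv (chebyshev d)) (cos \<theta>) * - sin \<theta>) (at \<theta>)"
    by (rule DERIV_chain2[OF poly_DERIV DERIV_cos])
  moreover have "((\<lambda>\<theta>. poly (chebyshev d) (cos \<theta>)) has_field_derivative
      - sin (of_nat d * \<theta>) * of_nat d) (at \<theta>)"
    unfolding chebyshev_cos by (auto intro!: derivative_eq_intros)
  ultimately show ?thesis
    using DERIV_unique by fastforce
qed

lemma chebyshev_second_order:
  assumes "poly (pderiv (chebyshev d)) (cos \<theta>) = 0"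
  shows "poly (pderiv (pderiv (chebyshev d))) (cos \<theta>) * (sin \<theta>)\<^sup>2 = - (of_nat d)\<^sup>2 * cos (of_nat d * \<theta>)"
proof -
  have "((\<lambda>\<theta>. poly (pderiv (chebyshev d)) (cos \<theta>) * sin \<theta>) has_field_derivative
      (poly (pderiv (pderiv (chebyshev d))) (cos \<theta>) * - sin \<theta>) * sin \<theta>) (at \<theta>)"
    by (rule DERIV_cong[OF DERIV_mult[OF DERIV_chain2[OF poly_DERIV DERIV_cos] DERIV_sin]])
      (simp add: assms)
  moreover have "((\<lambda>\<theta>. poly (pderiv (chebyshev d)) (cos \<theta>) * sin \<theta>) has_field_derivative
      of_nat d * (cos (of_nat d * \<theta>) * of_nat d)) (at \<theta>)"
    unfolding chebyshev_first_order by (auto intro!: derivative_eq_intros)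
  ultimately have "(poly (pderiv (pderiv (chebyshev d))) (cos \<theta>) * - sin \<theta>) * sin \<theta>
      = of_nat d * (cos (of_nat d * \<theta>) * of_nat d)"
    by (rule DERIV_unique)
  then have "- ((poly (pderiv (pderiv (chebyshev d))) (cos \<theta>) * - sin \<theta>) * sin \<theta>)
      = - (of_nat d * (cos (of_nat d * \<theta>) * of_nat d))"
    by (simp only:)
  then show ?thesis
    by (simp add: power2_eq_square mult_ac)
qed

text \<open>
  The same argument as for \<open>Q_d\<close>: at a critical point, \<open>cos (d * \<theta>)\<close> has a nonzero second derivative, and
  this excludes both a degenerate critical point and the branch points \<open>sin \<theta> = 0\<close> of the parametrization.
\<close>
lemma chebyshev_critical_nondegenerate:
  assumes "d > 0" "poly (pderiv (chebyshev d)) (cos \<theta>) = 0"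
  shows "sin \<theta> \<noteq> 0" "poly (pderiv (pderiv (chebyshev d))) (cos \<theta>) \<noteq> 0"
proof -
  have "sin (of_nat d * \<theta>) = 0"
    using chebyshev_first_order[of d \<theta>] assms by simp
  then have "cos (of_nat d * \<theta>) \<noteq> 0"
    using sin_cos_squared_add[of "of_nat d * \<theta>"] by auto
  then have "poly (pderiv (pderiv (chebyshev d))) (cos \<theta>) * (sin \<theta>)\<^sup>2 \<noteq> 0"
    unfolding chebyshev_second_order[OF assms(2)] using assms(1) by simp
  then show "sin \<theta> \<noteq> 0" "poly (pderiv (pderiv (chebyshev d))) (cos \<theta>) \<noteq> 0"
    by auto
qed

definition cheb_node :: "nat \<Rightarrow> nat \<Rightarrow> complex" where
  "cheb_node d k = of_real (cos (real k * pi / real d))"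

lemma chebyshev_critical_points:
  assumes "d > 0"
  shows "{w. poly (pderiv (chebyshev d)) w = 0} = cheb_node d ` {1..<d}"
proof (intro equalityI subsetI)
  fix w
  assume "w \<in> {w. poly (pderiv (chebyshev d)) w = 0}"
  then have w: "poly (pderiv (chebyshev d)) w = 0" by simp
  have *: "\<exists>j::int. of_nat d * \<theta> = of_real (of_int j * pi)" if "w = cos \<theta>" for \<theta>
    using chebyshev_first_order[of d \<theta>] w assms that by (simp add: sin_eq_0)
  obtain j :: int where "of_nat d * Arccos w = of_real (of_int j * pi)"
    using *[of "Arccos w"] by auto
  then have "Arccos w = of_real (of_int j * pi / real d)"
    using assms by (simp add: field_simps)
  then have "w = of_real (cos (of_int j * pi / real d))"
    by (metis cos_Arccos cos_of_real)
  \<comment> \<open>Folding the angle back into \<open>[0, pi]\<close> gives an index between 0 and \<open>d\<close>; the ends are excluded since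
    \<open>sin\<close> does not vanish there.\<close>
  define \<phi> where "\<phi> = arccos (cos (of_int j * pi / real d))"
  have \<phi>: "w = cos (of_real \<phi>)" "0 \<le> \<phi>" "\<phi> \<le> pi"
    using \<open>w = _\<close> by (simp_all add: \<phi>_def arccos_lbound arccos_ubound cos_of_real)
  have "sin (complex_of_real \<phi>) \<noteq> 0"
    using chebyshev_critical_nondegenerate(1)[OF assms, of "of_real \<phi>"] w \<phi>(1) by simp
  then have "sin \<phi> \<noteq> 0" by (metis of_real_0 sin_of_real)
  then have "\<phi> \<noteq> 0" "\<phi> \<noteq> pi" by auto
  obtain i :: int where "of_nat d * complex_of_real \<phi> = of_real (of_int i * pi)"
    using *[OF \<phi>(1)] by auto
  then have "complex_of_real (real d * \<phi>) = of_real (of_int i * pi)" by simp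
  then have i: "real d * \<phi> = of_int i * pi" by (simp only: of_real_eq_iff)
  have "0 < real d * \<phi>" "real d * \<phi> < real d * pi"
    using \<phi> \<open>\<phi> \<noteq> 0\<close> \<open>\<phi> \<noteq> pi\<close> assms by auto
  then have "0 < i" "i < int d"
    unfolding i by (auto simp: zero_less_mult_iff)
  then have "nat i \<in> {1..<d}" by auto
  moreover have "w = cheb_node d (nat i)"
  proof -
    have "\<phi> = of_int i * pi / real d" using i assms by (simp add: field_simps)
    then show ?thesis using \<phi>(1) \<open>0 < i\<close> unfolding cheb_node_def cos_of_real by simp
  qed
  ultimately show "w \<in> cheb_node d ` {1..<d}" by blast
next
  fix w
  assume "w \<in> cheb_node d ` {1..<d}"
  then obtain k where "k \<in> {1..<d}" and node: "w = cheb_node d k"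
    by blast
  then have k: "0 < k" "k < d"
    by auto
  from node have w: "w = cos (of_real (real k * pi / real d))"
    by (simp only: cheb_node_def cos_of_real)
  have "0 < real k * pi / real d" "real k * pi / real d < pi"
    using k by (simp_all add: field_simps)
  then have "sin (real k * pi / real d) \<noteq> 0" using sin_gt_zero by fastforce
  then have "sin (complex_of_real (real k * pi / real d)) \<noteq> 0"
    by (metis of_real_eq_0_iff sin_of_real)
  moreover have "sin (of_nat d * complex_of_real (real k * pi / real d)) = 0"
  proof -
    have "of_nat d * complex_of_real (real k * pi / real d) = of_real (of_int (int k) * pi)"
      using k by simp
    then show ?thesis unfolding sin_eq_0 by blast
  qed
  ultimately show "w \<in> {w. poly (pderiv (chebyshev d)) w = 0}"
    using chebyshev_first_order[of d "of_real (real k * pi / real d)"] w by auto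
qed

lemma chebyshev_node:
  assumes "d > 0"
  shows "poly (chebyshev d) (cheb_node d k) = (- 1) ^ k"
proof -
  have "poly (chebyshev d) (cheb_node d k) = cos (of_nat d * of_real (real k * pi / real d))"
    unfolding cheb_node_def cos_of_real[symmetric] by (rule chebyshev_cos)
  also have "of_nat d * complex_of_real (real k * pi / real d) = of_real (real k * pi)"
    using assms by simp
  also have "cos (complex_of_real (real k * pi)) = (- 1) ^ k"
    unfolding cos_of_real cos_npi by simp
  finally show ?thesis .
qed

lemma inj_on_cheb_node: "inj_on (cheb_node d) {1..<d}"
proof (rule inj_onI)
  fix j k
  assume jk: "j \<in> {1..<d}" "k \<in> {1..<d}" "cheb_node d j = cheb_node d k"
  then have "cos (real j * pi / real d) = cos (real k * pi / real d)"
    by (simp add: cheb_node_def)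
  moreover have "0 \<le> real i * pi / real d \<and> real i * pi / real d \<le> pi" if "i \<in> {1..<d}" for i
    using that by (simp add: field_simps)
  ultimately have "real j * pi / real d = real k * pi / real d"
    using jk cos_inj_pi by blast
  then show "j = k" using jk by simp
qed

lemma card_parity:
  "card {k \<in> {1..<d}. even k} = (d - 1) div 2" "card {k \<in> {1..<d}. odd k} = d div 2"
proof -
  have "card {k \<in> {1..<d}. even k} = (d - 1) div 2 \<and> card {k \<in> {1..<d}. odd k} = d div 2"
  proof (induction d)
    case (Suc d)
    have "card {k \<in> {1..<Suc d}. P k} = card {k \<in> {1..<d}. P k} + (if 1 \<le> d \<and> P d then 1 else 0)"
      for P
    proof -
      have "{k \<in> {1..<Suc d}. P k}
          = (if 1 \<le> d \<and> P d then insert d {k \<in> {1..<d}. P k} else {k \<in> {1..<d}. P k})"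
        by (auto simp: less_Suc_eq)
      then show ?thesis by simp
    qed
    then have "card {k \<in> {1..<Suc d}. even k} = (d - 1) div 2 + (if 1 \<le> d \<and> even d then 1 else 0)"
      "card {k \<in> {1..<Suc d}. odd k} = d div 2 + (if 1 \<le> d \<and> odd d then 1 else 0)"
      using Suc by auto
    moreover have "(d - 1) div 2 + (if 1 \<le> d \<and> even d then 1 else 0) = (Suc d - 1) div 2"
      "d div 2 + (if 1 \<le> d \<and> odd d then 1 else 0) = Suc d div 2"
      by presburger+
    ultimately show ?case by simp
  qed simp
  then show "card {k \<in> {1..<d}. even k} = (d - 1) div 2" "card {k \<in> {1..<d}. odd k} = d div 2"
    by auto
qed

definition T_crit :: "nat \<Rightarrow> complex \<Rightarrow> complex set" where
  "T_crit d v = {w. poly (pderiv (T_poly d)) w = 0 \<and> poly (T_poly d) w = v}"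

lemma pderiv_T_poly: "pderiv (T_poly d) = smult (1 / 2) (pderiv (chebyshev d))"
  by (simp add: T_poly_def pderiv_smult pderiv_add pderiv_pCons)

lemma T_crit_eq:
  assumes "d > 0"
  shows "T_crit d v = cheb_node d ` {k \<in> {1..<d}. (if even k then 3 else 2) = v}"
proof -
  have "T_crit d v = {w \<in> {w. poly (pderiv (chebyshev d)) w = 0}. poly (T_poly d) w = v}"
    by (auto simp: T_crit_def pderiv_T_poly)
  also have "\<dots> = cheb_node d ` {k \<in> {1..<d}. (if even k then 3 else 2) = v}"
  proof -
    have val: "poly (T_poly d) (cheb_node d k) = (if even k then 3 else 2)" for k
      by (simp add: T_poly_def chebyshev_node[OF assms])
    have filter: "{w \<in> f ` S. P w} = f ` {k \<in> S. P (f k)}" for f :: "nat \<Rightarrow> complex" and S P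
      by auto
    show ?thesis
      unfolding chebyshev_critical_points[OF assms] filter val ..
  qed
  finally show ?thesis .
qed

lemma card_T_crit:
  assumes "d > 0"
  shows "card (T_crit d 2) = d div 2" "card (T_crit d 3) = (d - 1) div 2"
proof -
  have "{k \<in> {1..<d}. (if even k then 3 else 2) = (2::complex)} = {k \<in> {1..<d}. odd k}"
    "{k \<in> {1..<d}. (if even k then 3 else 2) = (3::complex)} = {k \<in> {1..<d}. even k}"
    by auto
  moreover have "card (cheb_node d ` {k \<in> {1..<d}. P k}) = card {k \<in> {1..<d}. P k}" for P
    by (intro card_image inj_on_subset[OF inj_on_cheb_node]) auto
  ultimately show "card (T_crit d 2) = d div 2" "card (T_crit d 3) = (d - 1) div 2"
    unfolding T_crit_eq[OF assms] by (simp_all only: card_parity)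
qed

lemma T_crit_cases:
  assumes "d > 0" "poly (pderiv (T_poly d)) w = 0"
  shows "w \<in> T_crit d 2 \<or> w \<in> T_crit d 3" "poly (pderiv (pderiv (T_poly d))) w \<noteq> 0"
proof -
  have crit: "poly (pderiv (chebyshev d)) w = 0" using assms(2) by (simp add: pderiv_T_poly)
  then have "w \<in> cheb_node d ` {1..<d}"
    using chebyshev_critical_points[OF assms(1)] by blast
  then obtain k where "k \<in> {1..<d}" "w = cheb_node d k" by blast
  then show "w \<in> T_crit d 2 \<or> w \<in> T_crit d 3"
    unfolding T_crit_eq[OF assms(1)] by auto
  show "poly (pderiv (pderiv (T_poly d))) w \<noteq> 0"
    using chebyshev_critical_nondegenerate(2)[of d "Arccos w"] assms(1) crit
    by (simp add: pderiv_T_poly pderiv_smult)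
qed

section \<open>Homogenization\<close>

definition total_degree_le :: "nat \<Rightarrow> complex poly poly \<Rightarrow> bool" where
  "total_degree_le n f \<longleftrightarrow> (\<forall>j i. coeff (coeff f j) i \<noteq> 0 \<longrightarrow> i + j \<le> n)"

lemma total_degree_le_mono: "total_degree_le m f \<Longrightarrow> m \<le> n \<Longrightarrow> total_degree_le n f"
  by (force simp: total_degree_le_def)

lemma total_degree_le_add:
  "total_degree_le n f \<Longrightarrow> total_degree_le n g \<Longrightarrow> total_degree_le n (f + g)"
  by (force simp: total_degree_le_def)

lemma total_degree_le_diff:
  "total_degree_le n f \<Longrightarrow> total_degree_le n g \<Longrightarrow> total_degree_le n (f - g)"
  by (force simp: total_degree_le_def)

lemma total_degree_le_smult: "total_degree_le n f \<Longrightarrow> total_degree_le n (smult [:c:] f)"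
  by (force simp: total_degree_le_def)

lemma total_degree_le_const: "total_degree_le n [:[:c:]:]"
  by (auto simp: total_degree_le_def coeff_pCons split: nat.splits)

lemma total_degree_le_X: "total_degree_le n f \<Longrightarrow> total_degree_le (Suc n) (poly_X * f)"
  by (auto simp: total_degree_le_def coeff_pCons split: nat.splits)

lemma total_degree_le_Y: "total_degree_le n f \<Longrightarrow> total_degree_le (Suc n) (poly_Y * f)"
  by (auto simp: total_degree_le_def coeff_pCons split: nat.splits)

lemma total_degree_le_power_sum:
  assumes P: "\<And>n f. total_degree_le n f \<Longrightarrow> total_degree_le (Suc n) (P * f)"
    and Q: "\<And>n f. total_degree_le n f \<Longrightarrow> total_degree_le (Suc n) (Q * f)"
  shows "total_degree_le k (power_sum P Q 1 k)"
proof (induction k rule: less_induct)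
  case (less k)
  have one: "total_degree_le n 1" for n
    using total_degree_le_const[of n 1] by (simp add: one_pCons)
  have P1: "total_degree_le (Suc 0) P" using P[OF one[of 0]] by simp
  have Q1: "total_degree_le (Suc 0) Q" using Q[OF one[of 0]] by simp
  consider "k = 0" | "k = Suc 0" | "k = Suc (Suc 0)" | m where "k = Suc (Suc (Suc m))"
    by (metis not0_implies_Suc)
  then show ?case
  proof cases
    case 1
    have "(3 :: complex poly poly) = [:[:3:]:]" by (simp add: numeral_poly)
    with 1 show ?thesis using total_degree_le_const[of 0 3] by simp
  next
    case 2
    with P1 show ?thesis by simp
  next
    case 3
    have "total_degree_le k (smult [:2:] Q)"
      by (rule total_degree_le_mono[OF total_degree_le_smult[OF Q1]]) (simp add: 3)
    moreover have "smult [:2:] Q = 2 * Q"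
      by (simp add: numeral_poly)
    ultimately show ?thesis
      using P[OF P1] by (simp add: 3 power2_eq_square total_degree_le_diff)
  next
    case 4
    have "total_degree_le k (P * power_sum P Q 1 (Suc (Suc m)))"
      using P[OF less[of "Suc (Suc m)"]] 4 by simp
    moreover have "total_degree_le k (Q * power_sum P Q 1 (Suc m))"
      using Q[OF less[of "Suc m"]] 4 by (auto elim: total_degree_le_mono)
    moreover have "total_degree_le k (power_sum P Q 1 m)"
      using less[of m] 4 by (auto elim: total_degree_le_mono)
    ultimately show ?thesis
      by (simp add: 4 total_degree_le_diff total_degree_le_add)
  qed
qed

lemma total_degree_le_folding: "total_degree_le d (folding_poly d)"
  unfolding folding_poly_def
  by (intro total_degree_le_add total_degree_le_smult total_degree_le_power_sum
      total_degree_le_X total_degree_le_Y)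

lemma degree_cheb_le: "degree (cheb [:0, 1:] 1 k :: complex poly) \<le> k"
proof (induction "[:0, 1:] :: complex poly" "1 :: complex poly" k rule: cheb.induct)
  case (3 k)
  have "degree (2 * [:0, 1:] * cheb [:0, 1:] 1 (Suc k) :: complex poly)
      \<le> degree (2 * [:0, 1:] :: complex poly) + degree (cheb [:0, 1:] 1 (Suc k) :: complex poly)"
    by (rule degree_mult_le)
  also have "\<dots> \<le> Suc (Suc k)"
    using 3(1) by (simp add: numeral_poly)
  finally show ?case
    using 3(2) by (simp add: degree_diff_le)
qed simp_all

lemma degree_T_poly: "degree (T_poly d) \<le> d"
  unfolding T_poly_def chebyshev_eq
  by (rule order.trans[OF degree_smult_le]) (intro degree_add_le degree_cheb_le, simp)

lemma poly2_altdef: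
  "poly2 g x y = (\<Sum>j\<le>degree g. \<Sum>i\<le>degree (coeff g j). coeff (coeff g j) i * x ^ i * y ^ j)"
  by (simp add: poly2_def poly_altdef[of g] poly_sum poly_altdef[of "coeff g _"] sum_distrib_right)

text \<open>
  The degree bound makes the exponent of \<open>p $ 4\<close> a true difference.
\<close>
lemma homogenize_eq:
  assumes bound: "\<And>k j i. coeff (coeff (coeff f k) j) i \<noteq> 0 \<Longrightarrow> i + j + k \<le> d"
    and nz: "p $ 4 \<noteq> 0"
  shows "homogenize d f p
    = p $ 4 ^ d * poly2 (poly f [:[:p $ 3 / p $ 4:]:]) (p $ 1 / p $ 4) (p $ 2 / p $ 4)"
proof -
  define x y w z where "x = p $ 1" and "y = p $ 2" and "w = p $ 3" and "z = p $ 4"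
  note xyz = this
  have summand: "coeff (coeff (coeff f k) j) i * x ^ i * y ^ j * w ^ k * z ^ (d - (i + j + k))
      = z ^ d * (coeff (coeff (coeff f k) j) i * (x / z) ^ i * (y / z) ^ j * (w / z) ^ k)" for i j k
  proof (cases "coeff (coeff (coeff f k) j) i = 0")
    case False
    have "z ^ d = z ^ (d - (i + j + k)) * z ^ (i + j + k)"
      using bound[OF False] by (simp flip: power_add)
    then show ?thesis
      using nz by (simp add: xyz power_divide power_add field_simps)
  qed simp
  have "poly2 (poly f [:[:w / z:]:]) (x / z) (y / z)
      = (\<Sum>k\<le>degree f. poly2 (coeff f k) (x / z) (y / z) * (w / z) ^ k)"
    by (simp add: poly_altdef[of f] poly2_def poly_sum)
  also have "z ^ d * \<dots> = homogenize d f p"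
    unfolding homogenize_def xyz[symmetric] summand poly2_altdef
    by (simp add: sum_distrib_left sum_distrib_right)
  finally show ?thesis by (simp add: xyz)
qed

lemma poly_affine_eq:
  "poly2 (poly (affine_eq d) [:[:w:]:]) x y = poly2 (folding_poly d) x y + poly (T_poly d) w"
proof -
  have "poly (map_poly (\<lambda>c. [:[:c:]:]) p) [:[:w:]:] = [:[:poly p w:]:]" for p :: "complex poly"
    by (induction p) (simp_all add: map_poly_pCons)
  then show ?thesis
    by (simp add: affine_eq_def Q_poly_eq_folding)
qed

lemma affine_eq_bound:
  assumes "coeff (coeff (coeff (affine_eq d) k) j) i \<noteq> 0"
  shows "i + j + k \<le> d"
proof (cases "k = 0")
  case True
  have "total_degree_le d (folding_poly d + [:[:coeff (T_poly d) 0:]:])"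
    by (intro total_degree_le_add total_degree_le_folding total_degree_le_const)
  then show ?thesis
    using True assms
    by (auto simp: affine_eq_def Q_poly_eq_folding coeff_map_poly total_degree_le_def)
next
  case False
  then have *: "coeff (coeff [:[:coeff (T_poly d) k:]:] j) i \<noteq> 0"
    using assms by (auto simp: affine_eq_def coeff_map_poly coeff_pCons split: nat.splits)
  then have "i + j = 0" using total_degree_le_const[of 0] unfolding total_degree_le_def by blast
  moreover from * have "coeff (T_poly d) k \<noteq> 0"
    by auto
  then have "k \<le> d" using le_degree degree_T_poly order.trans by blast
  ultimately show ?thesis by simp
qed

lemma U_eq_affine:
  assumes "p $ 4 \<noteq> 0"
  shows "U_eq d p = p $ 4 ^ d *
    (poly2 (folding_poly d) (p $ 1 / p $ 4) (p $ 2 / p $ 4) + poly (T_poly d) (p $ 3 / p $ 4))"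
proof -
  have "homogenize d (affine_eq d) p = p $ 4 ^ d *
      poly2 (poly (affine_eq d) [:[:p $ 3 / p $ 4:]:]) (p $ 1 / p $ 4) (p $ 2 / p $ 4)"
    by (rule homogenize_eq[OF _ assms]) (rule affine_eq_bound)
  then show ?thesis unfolding U_eq_def poly_affine_eq .
qed

lemma continuous_on_power_sum:
  fixes a b c :: "complex \<Rightarrow> complex"
  assumes "continuous_on S a" "continuous_on S b" "continuous_on S c"
  shows "continuous_on S (\<lambda>z. power_sum (a z) (b z) (c z) k)"
proof (induction k rule: less_induct)
  case (less k)
  consider "k = 0" | "k = Suc 0" | "k = Suc (Suc 0)" | m where "k = Suc (Suc (Suc m))"
    by (metis not0_implies_Suc)
  then show ?case
    by cases (use less assms in \<open>auto intro!: continuous_intros\<close>)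
qed

lemma continuous_on_cheb:
  fixes a b :: "complex \<Rightarrow> complex"
  assumes "continuous_on S a" "continuous_on S b"
  shows "continuous_on S (\<lambda>z. cheb (a z) (b z) k)"
proof (induction k rule: less_induct)
  case (less k)
  consider "k = 0" | "k = Suc 0" | m where "k = Suc (Suc m)"
    by (metis not0_implies_Suc)
  then show ?case
    by cases (use less assms in \<open>auto intro!: continuous_intros\<close>)
qed

text \<open>
  Both sides are continuous in \<open>p $ 4\<close>, so the affine formula, valid for \<open>p $ 4 \<noteq> 0\<close>, extends to the plane at
  infinity without computing the leading form of \<open>Q_d\<close> coefficient by coefficient.
\<close>
lemma U_eq_homogeneous:
  "U_eq d p = omega * power_sum (p $ 1) (p $ 2 * p $ 4) (p $ 4 ^ 3) d
     + omega\<^sup>2 * power_sum (p $ 2) (p $ 1 * p $ 4) (p $ 4 ^ 3) d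
     + (cheb (p $ 3) ((p $ 4)\<^sup>2) d + 5 * p $ 4 ^ d) / 2"
proof -
  define q where "q z = (\<chi> i. if i = 4 then z else p $ i)" for z
  define F where "F z = U_eq d (q z)" for z
  define G where "G z = omega * power_sum (p $ 1) (p $ 2 * z) (z ^ 3) d
     + omega\<^sup>2 * power_sum (p $ 2) (p $ 1 * z) (z ^ 3) d + (cheb (p $ 3) (z\<^sup>2) d + 5 * z ^ d) / 2" for z
  have q: "q z $ 1 = p $ 1" "q z $ 2 = p $ 2" "q z $ 3 = p $ 3" "q z $ 4 = z" for z
    by (simp_all add: q_def)
  have nz: "F z - G z = 0" if "z \<noteq> 0" for z
  proof -
    have P: "power_sum a (b * z) (z ^ 3) d = z ^ d * power_sum (a / z) (b / z) 1 d" for a b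
      using power_sum_scale[of z "a / z" "b / z" 1 d] that by (simp add: power2_eq_square mult.commute)
    have C: "cheb w (z\<^sup>2) d = z ^ d * cheb (w / z) 1 d" for w
      using cheb_scale[of z "w / z" 1 d] that by simp
    have "F z = z ^ d * (poly2 (folding_poly d) (p $ 1 / z) (p $ 2 / z) + poly (T_poly d) (p $ 3 / z))"
      unfolding F_def using that by (subst U_eq_affine) (simp_all add: q)
    also have "\<dots> = G z"
      unfolding G_def P C poly2_folding T_poly_def chebyshev_eq by (simp add: algebra_simps add_divide_distrib)
    finally show ?thesis by simp
  qed
  have "continuous_on UNIV F"
    unfolding F_def U_eq_def homogenize_def q
    by (intro continuous_on_sum continuous_on_mult continuous_on_power continuous_on_const continuous_on_id)
  moreover have "continuous_on UNIV G"
    unfolding G_def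
    by (intro continuous_on_add continuous_on_divide continuous_on_power_sum continuous_on_cheb
        continuous_on_mult continuous_on_power continuous_on_const continuous_on_id) simp
  ultimately have "continuous_on UNIV (\<lambda>z. F z - G z)"
    by (rule continuous_on_diff)
  then have "F z - G z = 0" for z
    using continuous_constant_on_closure[of "- {0}" "\<lambda>z. F z - G z" 0 z] nz
    by (simp add: closure_complement)
  from this[of "p $ 4"] have "F (p $ 4) = G (p $ 4)" by simp
  moreover have "q (p $ 4) = p" by (simp add: q_def vec_eq_iff)
  ultimately show ?thesis by (simp add: F_def G_def)
qed

lemma U_eq_infinity:
  assumes "p $ 4 = 0" "d > 0"
  shows "U_eq d p = omega * p $ 1 ^ d + omega\<^sup>2 * p $ 2 ^ d + 2 ^ (d - 1) / 2 * p $ 3 ^ d"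
proof -
  obtain k where "d = Suc k" using assms(2) gr0_implies_Suc by blast
  then show ?thesis
    using assms(1) by (simp add: U_eq_homogeneous power_sum_leading cheb_leading del: power_Suc)
qed

section \<open>Singular points in homogeneous and in affine coordinates\<close>

text \<open>
  The curve at infinity is a Fermat curve up to nonzero coefficients. Its smoothness already
  contradicts the vanishing of the three partial derivatives that keep \<open>p $ 4 = 0\<close>.
\<close>
lemma no_singularity_at_infinity:
  assumes "p $ 4 = 0" "d \<ge> 2" "\<And>i. partial_deriv i (U_eq d) p = 0"
  shows "p = 0"
proof -
  have d: "d > 0" using assms(2) by simp
  have deriv: "deriv (\<lambda>t. a * t ^ d + c) b = a * of_nat d * b ^ (d - 1)" for a b c :: complex
    by (rule DERIV_imp_deriv) (auto intro!: derivative_eq_intros)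
  have "partial_deriv 1 (U_eq d) p = omega * of_nat d * p $ 1 ^ (d - 1)"
    unfolding partial_deriv_def deriv[symmetric, where c = "omega\<^sup>2 * p $ 2 ^ d + 2 ^ (d - 1) / 2 * p $ 3 ^ d"]
    by (rule arg_cong2[where f = deriv]) (auto simp: U_eq_infinity d assms(1))
  moreover have "partial_deriv 2 (U_eq d) p = omega\<^sup>2 * of_nat d * p $ 2 ^ (d - 1)"
    unfolding partial_deriv_def deriv[symmetric, where c = "omega * p $ 1 ^ d + 2 ^ (d - 1) / 2 * p $ 3 ^ d"]
    by (rule arg_cong2[where f = deriv]) (auto simp: U_eq_infinity d assms(1))
  moreover have "partial_deriv 3 (U_eq d) p = 2 ^ (d - 1) / 2 * of_nat d * p $ 3 ^ (d - 1)"
    unfolding partial_deriv_def deriv[symmetric, where c = "omega * p $ 1 ^ d + omega\<^sup>2 * p $ 2 ^ d"]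
    by (rule arg_cong2[where f = deriv]) (auto simp: U_eq_infinity d assms(1))
  ultimately have "p $ 1 = 0" "p $ 2 = 0" "p $ 3 = 0"
    using assms(3)[of 1] assms(3)[of 2] assms(3)[of 3] d omega_power(2) by simp_all
  with assms(1) show ?thesis
    by (simp add: vec_eq_iff forall_4)
qed

definition affine_singular :: "nat \<Rightarrow> (complex \<times> complex \<times> complex) set" where
  "affine_singular d = {(x, y, w). (x, y) \<in> crit_points d \<and> poly (pderiv (T_poly d)) w = 0
                          \<and> poly2 (folding_poly d) x y + poly (T_poly d) w = 0}"

text \<open>
  The fourth partial derivative is, as in Euler's relation, a combination of the polynomial and its
  three affine partial derivatives, so it imposes no further condition.
\<close>
lemma singular_iff_affine_singular:
  assumes nz: "p $ 4 \<noteq> 0"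
  shows "U_eq d p = 0 \<and> (\<forall>i. partial_deriv i (U_eq d) p = 0)
    \<longleftrightarrow> (p $ 1 / p $ 4, p $ 2 / p $ 4, p $ 3 / p $ 4) \<in> affine_singular d"
proof -
  define x y w z where "x = p $ 1" and "y = p $ 2" and "w = p $ 3" and "z = p $ 4"
  note xyz = this
  define q where "q i t = (\<chi> j. if j = i then t else p $ j)" for i t
  define f fx fy fw where "f = poly2 (folding_poly d) (x / z) (y / z) + poly (T_poly d) (w / z)"
    and "fx = poly2 (pderiv_x (folding_poly d)) (x / z) (y / z)"
    and "fy = poly2 (pderiv (folding_poly d)) (x / z) (y / z)"
    and "fw = poly (pderiv (T_poly d)) (w / z)"
  have z: "z \<noteq> 0" using nz by (simp add: xyz)
  have chain: "((\<lambda>t. c t * (poly2 (folding_poly d) (X t) (Y t) + poly (T_poly d) (W t)))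
      has_field_derivative C' * f + z ^ d * (fx * X' + fy * Y' + fw * W')) (at s)"
    if "(c has_field_derivative C') (at s)" "(X has_field_derivative X') (at s)"
      "(Y has_field_derivative Y') (at s)" "(W has_field_derivative W') (at s)"
      "c s = z ^ d" "X s = x / z" "Y s = y / z" "W s = w / z" for c X Y W C' X' Y' W' s
    by (rule DERIV_cong[OF DERIV_mult[OF that(1) DERIV_add[OF
            has_field_derivative_poly2[OF that(2,3)] DERIV_chain2[OF poly_DERIV that(4)]]]])
      (simp add: that(5-8) f_def fx_def fy_def fw_def mult.commute)
  have divide: "((\<lambda>t. t / z) has_field_derivative 1 / z) (at s)" for s
    by (rule DERIV_cdivide[OF DERIV_ident])
  have q1: "U_eq d (q 1 t) = z ^ d * (poly2 (folding_poly d) (t / z) (y / z) + poly (T_poly d) (w / z))" for t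
    using nz by (subst U_eq_affine) (simp_all add: q_def xyz)
  have q2: "U_eq d (q 2 t) = z ^ d * (poly2 (folding_poly d) (x / z) (t / z) + poly (T_poly d) (w / z))" for t
    using nz by (subst U_eq_affine) (simp_all add: q_def xyz)
  have q3: "U_eq d (q 3 t) = z ^ d * (poly2 (folding_poly d) (x / z) (y / z) + poly (T_poly d) (t / z))" for t
    using nz by (subst U_eq_affine) (simp_all add: q_def xyz)
  have q4: "U_eq d (q 4 t) = t ^ d * (poly2 (folding_poly d) (x / t) (y / t) + poly (T_poly d) (w / t))"
    if "t \<noteq> 0" for t
    using that by (subst U_eq_affine) (simp_all add: q_def xyz)
  have d1: "partial_deriv 1 (U_eq d) p = z ^ d * fx / z"
    unfolding partial_deriv_def q_def[symmetric] q1 xyz(1)[symmetric]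
    by (rule DERIV_imp_deriv, rule DERIV_cong,
        rule chain[OF DERIV_const divide DERIV_const DERIV_const]) simp_all
  have d2: "partial_deriv 2 (U_eq d) p = z ^ d * fy / z"
    unfolding partial_deriv_def q_def[symmetric] q2 xyz(2)[symmetric]
    by (rule DERIV_imp_deriv, rule DERIV_cong,
        rule chain[OF DERIV_const DERIV_const divide DERIV_const]) simp_all
  have d3: "partial_deriv 3 (U_eq d) p = z ^ d * fw / z"
    unfolding partial_deriv_def q_def[symmetric] q3 xyz(3)[symmetric]
    by (rule DERIV_imp_deriv, rule DERIV_cong,
        rule chain[OF DERIV_const DERIV_const DERIV_const divide]) simp_all
  have d4: "partial_deriv 4 (U_eq d) p
      = of_nat d * z ^ (d - 1) * f - z ^ d * (fx * x + fy * y + fw * w) / z\<^sup>2"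
  proof -
    have inv: "((\<lambda>t. a / t) has_field_derivative - a / z\<^sup>2) (at z)" for a
      using z by (auto intro!: derivative_eq_intros simp: power2_eq_square)
    have pow: "((\<lambda>t. t ^ d) has_field_derivative of_nat d * z ^ (d - 1)) (at z)"
      by (auto intro!: derivative_eq_intros)
    have "((\<lambda>t. t ^ d * (poly2 (folding_poly d) (x / t) (y / t) + poly (T_poly d) (w / t)))
      has_field_derivative of_nat d * z ^ (d - 1) * f
        + z ^ d * (fx * (- x / z\<^sup>2) + fy * (- y / z\<^sup>2) + fw * (- w / z\<^sup>2))) (at z)"
      by (rule chain[OF pow inv inv inv]) simp_all
    then have "((\<lambda>t. U_eq d (q 4 t)) has_field_derivative of_nat d * z ^ (d - 1) * f
        + z ^ d * (fx * (- x / z\<^sup>2) + fy * (- y / z\<^sup>2) + fw * (- w / z\<^sup>2))) (at z)"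
      by (rule has_field_derivative_transform_within_open[where S = "- {0}"]) (auto simp: z q4)
    then have "deriv (\<lambda>t. U_eq d (q 4 t)) z = of_nat d * z ^ (d - 1) * f
        + z ^ d * (fx * (- x / z\<^sup>2) + fy * (- y / z\<^sup>2) + fw * (- w / z\<^sup>2))"
      by (rule DERIV_imp_deriv)
    then show ?thesis
      unfolding partial_deriv_def q_def[symmetric] xyz(4)[symmetric]
      by (simp add: add_divide_distrib diff_divide_distrib algebra_simps)
  qed
  have "U_eq d p = z ^ d * f"
    using U_eq_affine[OF nz] by (simp add: f_def xyz)
  moreover have "(x / z, y / z, w / z) \<in> affine_singular d \<longleftrightarrow> fx = 0 \<and> fy = 0 \<and> fw = 0 \<and> f = 0"
    by (simp add: affine_singular_def crit_points_def f_def fx_def fy_def fw_def)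
  ultimately show ?thesis
    using z unfolding forall_4 d1 d2 d3 d4 xyz[symmetric] by auto
qed

definition affine_point :: "complex \<times> complex \<times> complex \<Rightarrow> complex ^ 4" where
  "affine_point = (\<lambda>(x, y, w). \<chi> i. if i = 1 then x else if i = 2 then y else if i = 3 then w else 1)"

lemma affine_point_nth:
  "affine_point (x, y, w) $ 1 = x" "affine_point (x, y, w) $ 2 = y"
  "affine_point (x, y, w) $ 3 = w" "affine_point s $ 4 = 1"
  by (simp_all add: affine_point_def split: prod.split)

lemma affine_point_nonzero: "affine_point s \<noteq> 0"
  using affine_point_nth(4)[of s] by auto

lemma equiv_proj_rel: "equiv (UNIV - {0}) proj_rel"
proof (rule equivI)
  show "proj_rel \<subseteq> (UNIV - {0}) \<times> (UNIV - {0})"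
    by (auto simp: proj_rel_def)
  show "refl_on (UNIV - {0}) proj_rel"
    by (auto simp: refl_on_def proj_rel_def intro!: exI[of _ 1])
  show "sym proj_rel"
  proof (rule symI)
    fix p q :: "complex ^ 4"
    assume "(p, q) \<in> proj_rel"
    then obtain c where "p \<noteq> 0" "q \<noteq> 0" "c \<noteq> 0" "q = c *s p" by (auto simp: proj_rel_def)
    then show "(q, p) \<in> proj_rel"
      by (auto simp: proj_rel_def vector_smult_assoc intro!: exI[of _ "inverse c"])
  qed
  show "trans proj_rel"
  proof (rule transI)
    fix p q r :: "complex ^ 4"
    assume "(p, q) \<in> proj_rel" "(q, r) \<in> proj_rel"
    then obtain c c' where "p \<noteq> 0" "r \<noteq> 0" "c \<noteq> 0" "q = c *s p" "c' \<noteq> 0" "r = c' *s q"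
      by (auto simp: proj_rel_def)
    then show "(p, r) \<in> proj_rel"
      by (auto simp: proj_rel_def vector_smult_assoc intro!: exI[of _ "c' * c"])
  qed
qed

definition line_through :: "complex \<times> complex \<times> complex \<Rightarrow> (complex ^ 4) set" where
  "line_through s = proj_rel `` {affine_point s}"

lemma affine_point_in_line: "affine_point s \<in> line_through s"
  using equiv_class_self[OF equiv_proj_rel, of "affine_point s"] affine_point_nonzero
  by (simp add: line_through_def)

lemma inj_line_through: "inj line_through"
proof (rule injI)
  fix s s'
  assume "line_through s = line_through s'"
  then have "affine_point s' \<in> line_through s"
    using affine_point_in_line by simp
  then obtain c where c: "affine_point s' = c *s affine_point s"
    by (auto simp: line_through_def proj_rel_def)
  have "affine_point s' $ 4 = c * affine_point s $ 4" by (simp add: c)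
  then have "c = 1" by (simp add: affine_point_nth(4))
  with c have "affine_point s' = affine_point s" by simp
  then show "s = s'"
    by (cases s; cases s') (metis affine_point_nth(1-3))
qed

lemma singular_points_eq:
  assumes "d \<ge> 2"
  shows "singular_points d = line_through ` affine_singular d"
proof (intro equalityI subsetI)
  fix L
  assume L: "L \<in> singular_points d"
  then obtain p where p: "p \<noteq> 0" "L = proj_rel `` {p}"
    by (auto simp: singular_points_def U_def P3_def quotient_def)
  then have "p \<in> L" using equiv_class_self[OF equiv_proj_rel] by simp
  with L have sing: "U_eq d p = 0 \<and> (\<forall>i. partial_deriv i (U_eq d) p = 0)"
    by (auto simp: singular_points_def U_def)
  then have nz: "p $ 4 \<noteq> 0"
    using no_singularity_at_infinity[of p d] assms p(1) by blast
  define s where "s = (p $ 1 / p $ 4, p $ 2 / p $ 4, p $ 3 / p $ 4)"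
  have "s \<in> affine_singular d"
    using sing singular_iff_affine_singular[OF nz] by (simp add: s_def)
  moreover have "affine_point s = inverse (p $ 4) *s p"
    using nz by (simp add: vec_eq_iff forall_4 s_def affine_point_nth divide_inverse mult.commute)
  then have "(p, affine_point s) \<in> proj_rel"
    using p(1) nz affine_point_nonzero[of s] by (auto simp: proj_rel_def intro!: exI[of _ "inverse (p $ 4)"])
  then have "L = line_through s"
    unfolding p(2) line_through_def by (rule equiv_class_eq[OF equiv_proj_rel])
  ultimately show "L \<in> line_through ` affine_singular d" by blast
next
  fix L
  assume "L \<in> line_through ` affine_singular d"
  then obtain x y w where s: "(x, y, w) \<in> affine_singular d" and L: "L = line_through (x, y, w)"
    by auto
  have "L \<in> P3"
    unfolding L line_through_def P3_def by (rule quotientI) (simp add: affine_point_nonzero)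
  moreover have "U_eq d p = 0 \<and> (\<forall>i. partial_deriv i (U_eq d) p = 0)" if "p \<in> L" for p
  proof -
    from that obtain c where c: "c \<noteq> 0" "p = c *s affine_point (x, y, w)"
      by (auto simp: L line_through_def proj_rel_def)
    then have "p $ 4 \<noteq> 0" and ratios: "(p $ 1 / p $ 4, p $ 2 / p $ 4, p $ 3 / p $ 4) = (x, y, w)"
      by (simp_all add: affine_point_nth)
    from singular_iff_affine_singular[OF this(1), of d] show ?thesis
      unfolding ratios using s by blast
  qed
  ultimately show "L \<in> singular_points d"
    unfolding singular_points_def U_def by blast
qed

section \<open>Non-degeneracy\<close>

text \<open>
  This shape of function is preserved by partial derivatives, so that one lemma yields the Hessian.
\<close>
definition separated :: "complex poly poly \<Rightarrow> complex poly \<Rightarrow> complex ^ 3 \<Rightarrow> complex" where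
  "separated R S q = poly2 R (q $ 1) (q $ 2) + poly S (q $ 3)"

lemma partial_deriv_separated:
  "partial_deriv 1 (separated R S) = separated (pderiv_x R) 0"
  "partial_deriv 2 (separated R S) = separated (pderiv R) 0"
  "partial_deriv 3 (separated R S) = separated 0 (pderiv S)"
proof -
  have "deriv (\<lambda>t. poly2 R t y + c) x = poly2 (pderiv_x R) x y" for x y c
    using DERIV_add[OF has_field_derivative_poly2[OF DERIV_ident DERIV_const, of R y x] DERIV_const[of c]]
    by (intro DERIV_imp_deriv) simp
  then show "partial_deriv 1 (separated R S) = separated (pderiv_x R) 0"
    by (simp add: fun_eq_iff partial_deriv_def separated_def)
  have "deriv (\<lambda>t. poly2 R x t + c) y = poly2 (pderiv R) x y" for x y c
    using DERIV_add[OF has_field_derivative_poly2[OF DERIV_const DERIV_ident, of R x y] DERIV_const[of c]]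
    by (intro DERIV_imp_deriv) simp
  then show "partial_deriv 2 (separated R S) = separated (pderiv R) 0"
    by (simp add: fun_eq_iff partial_deriv_def separated_def)
  have "deriv (\<lambda>t. c + poly S t) w = poly (pderiv S) w" for w c
    using DERIV_add[OF DERIV_const[of c] poly_DERIV[of S w]]
    by (intro DERIV_imp_deriv) simp
  then show "partial_deriv 3 (separated R S) = separated 0 (pderiv S)"
    by (simp add: fun_eq_iff partial_deriv_def separated_def)
qed

lemma U_eq_chart: "(\<lambda>q. U_eq d (chart 4 q)) = separated (folding_poly d) (T_poly d)"
proof
  fix q
  have "chart 4 q $ 1 = q $ 1" "chart 4 q $ 2 = q $ 2" "chart 4 q $ 3 = q $ 3" "chart 4 q $ 4 = 1"
    by (simp_all add: chart_def)
  then show "U_eq d (chart 4 q) = separated (folding_poly d) (T_poly d) q"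
    by (subst U_eq_affine) (simp_all add: separated_def)
qed

lemma nondegenerate_line_through:
  assumes "d > 0" "(x, y, w) \<in> affine_singular d"
  shows "nondegenerate d (line_through (x, y, w))"
proof -
  define q :: "complex ^ 3" where "q = vector [x, y, w]"
  have q: "q $ 1 = x" "q $ 2 = y" "q $ 3 = w" by (simp_all add: q_def)
  have "chart 4 q = affine_point (x, y, w)"
    by (simp add: vec_eq_iff forall_4 affine_point_nth chart_def q)
  then have "chart 4 q \<in> line_through (x, y, w)"
    by (simp add: affine_point_in_line)
  moreover have "det (hessian (\<lambda>q. U_eq d (chart 4 q)) q)
      = (poly2 (pderiv_x (pderiv_x (folding_poly d))) x y * poly2 (pderiv (pderiv (folding_poly d))) x y
         - (poly2 (pderiv_x (pderiv (folding_poly d))) x y)\<^sup>2) * poly (pderiv (pderiv (T_poly d))) w"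
    unfolding U_eq_chart det_3 hessian_def
    by (simp add: partial_deriv_separated separated_def q pderiv_x_pderiv
        power2_eq_square algebra_simps)
  moreover have "\<dots> \<noteq> 0"
    using assms crit_point_hessian_nonzero[of d x y] T_crit_cases(2)[of d w]
    by (simp add: affine_singular_def)
  ultimately show ?thesis
    unfolding nondegenerate_def by (metis invertible_det_nz)
qed

section \<open>The number of singular points\<close>

lemma card_crit_points_value:
  assumes "d > 0"
  defines "C \<equiv> \<lambda>v. {(x, y) \<in> crit_points d. poly2 (folding_poly d) x y = v}"
  shows "card (C v) = card {A \<in> crit_triples d. sum (two_cosh d) A = v}"
proof -
  have bij: "bij_betw plane_point (crit_triples d) (crit_points d)"
    using bij_betw_crit_points[OF assms(1)] .
  have "C v = plane_point ` {A \<in> crit_triples d. sum (two_cosh d) A = v}"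
  proof -
    have "C v = {s \<in> plane_point ` crit_triples d. case_prod (poly2 (folding_poly d)) s = v}"
      using bij by (auto simp: C_def bij_betw_def)
    also have "\<dots> = plane_point ` {A \<in> crit_triples d. case_prod (poly2 (folding_poly d)) (plane_point A) = v}"
      by blast
    also have "{A \<in> crit_triples d. case_prod (poly2 (folding_poly d)) (plane_point A) = v}
        = {A \<in> crit_triples d. sum (two_cosh d) A = v}"
      using folding_plane_point by auto
    finally show ?thesis .
  qed
  moreover have "inj_on plane_point {A \<in> crit_triples d. sum (two_cosh d) A = v}"
    using bij by (auto simp: bij_betw_def intro: inj_on_subset)
  ultimately show ?thesis by (simp add: card_image)
qed

text \<open>
  The critical values 2 and 3 of \<open>T_d\<close> must cancel the value of \<open>Q_d\<close>, so the critical points of \<open>Q_d\<close> with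
  value \<open>-2\<close> and \<open>-3\<close> are paired with those of \<open>T_d\<close>; the remaining critical value 6 of \<open>Q_d\<close> is not matched.
\<close>
lemma card_affine_singular:
  assumes "n \<ge> 1" "d = 3 * n"
  shows "finite (affine_singular d)"
    and "int (card (affine_singular d))
      = int (d choose 2) * int (d div 2) + (3 * (int n)\<^sup>2 - 3 * int n + 1) * int ((d - 1) div 2)"
proof -
  define C where "C = (\<lambda>v. {(x, y) \<in> crit_points d. poly2 (folding_poly d) x y = v})"
  have d: "d > 0" "d \<ge> 2" using assms by simp_all
  have C2: "card (C (- 2)) = d choose 2"
    unfolding C_def using card_crit_points_value[OF d(1)] card_crit_triples_minus2[OF d(1)] by simp
  have C3: "card (C (- 3)) + d = 3 * n\<^sup>2 + 1"
    unfolding C_def using card_crit_points_value[OF d(1)] card_crit_triples_minus3[OF assms] by simp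
  have "n \<le> n * n" by simp
  then have "d < 3 * n\<^sup>2 + 1"
    unfolding assms(2) power2_eq_square by linarith
  with C3 have fin3: "finite (C (- 3))" by (intro card_ge_0_finite) simp
  have fin2: "finite (C (- 2))"
    using C2 d(2) by (intro card_ge_0_finite) (simp add: zero_less_binomial_iff)
  have finT: "finite (T_crit d v)" for v by (simp add: T_crit_eq[OF d(1)])
  define S where "S = C (- 2) \<times> T_crit d 2 \<union> C (- 3) \<times> T_crit d 3"
  have S: "affine_singular d = (\<lambda>((x, y), w). (x, y, w)) ` S"
  proof -
    have "(x, y, w) \<in> affine_singular d \<longleftrightarrow> ((x, y), w) \<in> S" for x y w
    proof -
      have "poly2 (folding_poly d) x y + poly (T_poly d) w = 0
        \<longleftrightarrow> poly2 (folding_poly d) x y = - poly (T_poly d) w"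
        by (simp add: eq_neg_iff_add_eq_0)
      then show ?thesis
        using T_crit_cases(1)[OF d(1), of w]
        by (auto simp: affine_singular_def S_def C_def T_crit_def)
    qed
    then show ?thesis by (force simp: image_iff)
  qed
  have finS: "finite S" using fin2 fin3 finT by (simp add: S_def)
  then show "finite (affine_singular d)" by (simp add: S)
  have "card (affine_singular d) = card S"
    unfolding S by (rule card_image) (auto intro: inj_onI)
  also have "\<dots> = card (C (- 2)) * card (T_crit d 2) + card (C (- 3)) * card (T_crit d 3)"
    unfolding S_def using fin2 fin3 finT
    by (subst card_Un_disjoint) (auto simp: card_cartesian_product T_crit_def)
  finally have "int (card (affine_singular d))
      = int (d choose 2) * int (d div 2) + int (card (C (- 3))) * int ((d - 1) div 2)"
    by (simp add: C2 card_T_crit[OF d(1)])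
  moreover have "int (card (C (- 3))) = 3 * (int n)\<^sup>2 - 3 * int n + 1"
    using arg_cong[OF C3, of int] assms(2) by (simp add: power2_eq_square)
  ultimately show "int (card (affine_singular d))
      = int (d choose 2) * int (d div 2) + (3 * (int n)\<^sup>2 - 3 * int n + 1) * int ((d - 1) div 2)"
    by simp
qed

theorem mainTheorem2:
  fixes n d :: nat
  assumes "n \<ge> 1" and "d = 3 * n"
  shows "finite (singular_points d)
    \<and> real (card (singular_points d)) =
        real (d choose 2) * real_of_int \<lfloor>real d / 2\<rfloor>
        + ((real d)\<^sup>2 / 3 - real d + 1) * real_of_int \<lfloor>(real d - 1) / 2\<rfloor>
    \<and> (\<forall>L \<in> singular_points d. nondegenerate d L)
    \<and> (\<forall>L \<in> singular_points d. \<not> at_infinity_pt L)"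
proof -
  have d: "d > 0" "d \<ge> 2" using assms by simp_all
  note sing = singular_points_eq[OF d(2)]
  have "finite (singular_points d)"
    using card_affine_singular(1)[OF assms] by (simp add: sing)
  moreover have "real (card (singular_points d)) =
        real (d choose 2) * real_of_int \<lfloor>real d / 2\<rfloor>
        + ((real d)\<^sup>2 / 3 - real d + 1) * real_of_int \<lfloor>(real d - 1) / 2\<rfloor>"
  proof -
    have floor: "\<lfloor>real d / 2\<rfloor> = int (d div 2)" "\<lfloor>(real d - 1) / 2\<rfloor> = int ((d - 1) div 2)"
      using floor_divide_of_nat_eq[of d 2] floor_divide_of_nat_eq[of "d - 1" 2] d
      by (simp_all add: of_nat_diff)
    have "card (singular_points d) = card (affine_singular d)"
      unfolding sing by (intro card_image inj_on_subset[OF inj_line_through]) simp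
    then have "real_of_int (int (card (singular_points d))) = real_of_int (int (d choose 2) * int (d div 2)
        + (3 * (int n)\<^sup>2 - 3 * int n + 1) * int ((d - 1) div 2))"
      using card_affine_singular(2)[OF assms] by simp
    moreover have "(real d)\<^sup>2 / 3 - real d + 1 = real_of_int (3 * (int n)\<^sup>2 - 3 * int n + 1)"
      by (simp add: assms(2) power2_eq_square)
    ultimately show ?thesis
      unfolding floor by simp
  qed
  moreover have "nondegenerate d L" "\<not> at_infinity_pt L" if "L \<in> singular_points d" for L
  proof -
    from that obtain x y w where s: "(x, y, w) \<in> affine_singular d" "L = line_through (x, y, w)"
      by (auto simp: sing)
    then show "nondegenerate d L" using nondegenerate_line_through[OF d(1)] by simp
    show "\<not> at_infinity_pt L"
      using affine_point_in_line[of "(x, y, w)"] affine_point_nth(4)[of "(x, y, w)"] s(2)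
      unfolding at_infinity_pt_def by (metis zero_neq_one)
  qed
  ultimately show ?thesis by blast
qed

end
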